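(* Call an even self-dual $L$-code of length $n$ extremal if its minimal Euclidean weight equals $2\lfloor n/3\rfloor+2$. Extremal even self-dual $L$-codes of length $n$ exist for $n\in\{1,2,3,4,5,6,7,8,10,11\}$, and they do not exist for any length $n\geq 1$ with $n\notin\{1,2,3,4,5,6,7,8,10,11,14\}$ (the case $n=14$ is left open).
   Context: Let $L=\{0,1,\omega,\bar\omega\}$ be the Klein four-group $\mathbf{Z}_2\times\mathbf{Z}_2$. Define $|0|^2=0$, $|1|^2=1$, $|\omega|^2=|\bar\omega|^2=2$ and $q(x)=|x|^2\bmod 2$; the dot product on $L$ is $x\cdot y=q(x+y)-q(x)-q(y)\in\mathbf{F}_2$ (so $x\cdot y=1$ iff $x,y$ are distinct and nonzero). On $L^n$: scalar product $(\mathbf{x},\mathbf{y})=\sum_i x_i\cdot y_i$, Euclidean weight $\mathrm{ewt}(\mathbf{x})=\sum_i |x_i|^2$. An $L$-code of length $n$ is a subgroup $C\subseteq L^n$; $C^\perp=\{\mathbf{x}:(\mathbf{x},\mathbf{y})=0\ \forall\mathbf{y}\in C\}$; $C$ is self-dual if $C=C^\perp$, even if all codewords have even Euclidean weight. The minimal Euclidean weight of $C$ is $\min\{\mathrm{ewt}(\mathbf{x}):\mathbf{x}\in C\setminus\{0\}\}$. *)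

theory Defs
  imports "HOL-Algebra.Product_Groups" "HOL-Library.Z2" "HOL-Library.Product_Plus"
begin

type_synonym kleinian = "bit \<times> bit"

text \<open>
  The three nonzero elements of \<open>\<^bold>Z\<^sub>2 \<times> \<^bold>Z\<^sub>2\<close> are permuted transitively by its automorphisms,
  so it does not matter which one is called \<open>1\<close>. The choice of \<open>(1, 1)\<close> makes
  \<open>qform (a, b) = a * b\<close>.
\<close>

abbreviation k_one :: kleinian where "k_one \<equiv> (1, 1)"
abbreviation k_om :: kleinian where "k_om \<equiv> (1, 0)"
abbreviation k_ombar :: kleinian where "k_ombar \<equiv> (0, 1)"

definition klein_group :: "kleinian monoid" where
  "klein_group = \<lparr>carrier = UNIV, monoid.mult = (+), one = 0\<rparr>"

definition norm2 :: "kleinian \<Rightarrow> nat" where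
  "norm2 x = (if x = 0 then 0 else if x = k_one then 1 else 2)"

definition qform :: "kleinian \<Rightarrow> bit" where
  "qform x = of_nat (norm2 x)"

definition dot :: "kleinian \<Rightarrow> kleinian \<Rightarrow> bit" where
  "dot x y = qform (x + y) - qform x - qform y"

text \<open>Words of length \<open>n\<close> are functions on \<open>{..<n}\<close>, extended by \<open>undefined\<close>.\<close>

definition words :: "nat \<Rightarrow> (nat \<Rightarrow> kleinian) monoid" where
  "words n = product_group {..<n} (\<lambda>_. klein_group)"

definition scalar_product :: "nat \<Rightarrow> (nat \<Rightarrow> kleinian) \<Rightarrow> (nat \<Rightarrow> kleinian) \<Rightarrow> bit" where
  "scalar_product n x y = (\<Sum>i<n. dot (x i) (y i))"

definition ewt :: "nat \<Rightarrow> (nat \<Rightarrow> kleinian) \<Rightarrow> nat" where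
  "ewt n x = (\<Sum>i<n. norm2 (x i))"

definition L_code :: "nat \<Rightarrow> (nat \<Rightarrow> kleinian) set \<Rightarrow> bool" where
  "L_code n C \<longleftrightarrow> subgroup C (words n)"

definition dual :: "nat \<Rightarrow> (nat \<Rightarrow> kleinian) set \<Rightarrow> (nat \<Rightarrow> kleinian) set" where
  "dual n C = {x \<in> carrier (words n). \<forall>y\<in>C. scalar_product n x y = 0}"

definition self_dual :: "nat \<Rightarrow> (nat \<Rightarrow> kleinian) set \<Rightarrow> bool" where
  "self_dual n C \<longleftrightarrow> C = dual n C"

definition even_code :: "nat \<Rightarrow> (nat \<Rightarrow> kleinian) set \<Rightarrow> bool" where
  "even_code n C \<longleftrightarrow> (\<forall>x\<in>C. even (ewt n x))"

text \<open>
  \<open>Min\<close> is meaningful here, because a self-dual code of length \<open>n \<ge> 1\<close> is finite and nonzero.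
\<close>

definition min_ewt :: "nat \<Rightarrow> (nat \<Rightarrow> kleinian) set \<Rightarrow> nat" where
  "min_ewt n C = Min (ewt n ` (C - {\<one>\<^bsub>words n\<^esub>}))"

definition extremal_even_self_dual :: "nat \<Rightarrow> (nat \<Rightarrow> kleinian) set \<Rightarrow> bool" where
  "extremal_even_self_dual n C \<longleftrightarrow>
     L_code n C \<and> even_code n C \<and> self_dual n C \<and> min_ewt n C = 2 * (n div 3) + 2"

lemma dot_eq_1_iff: "dot x y = 1 \<longleftrightarrow> x \<noteq> y \<and> x \<noteq> 0 \<and> y \<noteq> 0"
  by (cases x; cases y; rename_tac a b c d; case_tac a; case_tac b; case_tac c; case_tac d)
     (simp_all add: dot_def qform_def norm2_def zero_prod_def)

lemma kleinian_cases: "x = 0 \<or> x = k_one \<or> x = k_om \<or> x = k_ombar"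
  by (cases x; rename_tac a b; case_tac a; case_tac b) (simp_all add: zero_prod_def)

lemma k_one_plus_k_om: "k_one + k_om = k_ombar"
  by simp

lemma group_klein_group: "group klein_group"
  unfolding klein_group_def
  by (rule groupI) (simp_all add: add.assoc del: split_paired_Ex, metis left_minus)

lemma group_words: "group (words n)"
  by (simp add: words_def group_klein_group)

lemma self_dual_nonzero:
  assumes "n \<ge> 1" "self_dual n C"
  shows "finite C" "C - {\<one>\<^bsub>words n\<^esub>} \<noteq> {}"
proof -
  have "(UNIV :: kleinian set) = {0, k_one, k_om, k_ombar}"
    using kleinian_cases by blast
  then have "finite (UNIV :: kleinian set)"
    by (metis finite.emptyI finite_insert)
  then have fin: "finite (carrier (words n))"
    by (simp add: words_def klein_group_def finite_PiE)
  show "finite C"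
    using assms fin by (auto simp: self_dual_def dual_def intro: finite_subset)
  have dot0: "dot x 0 = 0" for x
    using dot_eq_1_iff[of x 0] by (metis bit_not_one_iff)
  have z: "scalar_product n x (\<one>\<^bsub>words n\<^esub>) = 0" for x
    by (simp add: scalar_product_def words_def klein_group_def dot0)
  define e where "e = (\<lambda>i\<in>{..<n}. k_om)"
  have "e 0 \<noteq> \<one>\<^bsub>words n\<^esub> 0"
    using assms(1) by (simp add: e_def words_def klein_group_def zero_prod_def)
  then have e: "e \<in> carrier (words n)" "e \<noteq> \<one>\<^bsub>words n\<^esub>"
    by (force simp: e_def words_def klein_group_def, metis)
  show "C - {\<one>\<^bsub>words n\<^esub>} \<noteq> {}"
  proof
    assume "C - {\<one>\<^bsub>words n\<^esub>} = {}"
    then have "C \<subseteq> {\<one>\<^bsub>words n\<^esub>}" by auto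
    then have "e \<in> dual n C" using e z by (auto simp: dual_def)
    then show False using e \<open>C \<subseteq> _\<close> assms(2) by (auto simp: self_dual_def)
  qed
qed

end

theory Submission
  imports Defs "HOL-Computational_Algebra.Polynomial_FPS" "HOL-Library.More_List"
begin

text \<open>
  Let \<open>W(a, b, c)\<close> be the enumerator of an even self-dual code, where \<open>a\<close>, \<open>b\<close>, \<open>c\<close> mark the letters of
  norm 0, 1, 2. By the MacWilliams identity and evenness, \<open>W(x + y, x - y, z)\<close> is symmetric in
  \<open>x\<close>, \<open>y\<close>, \<open>z\<close>. Hence, with \<open>B = b\<^sup>2\<close>, \<open>W(1, b, c)\<close> is a combination of the products
  \<open>(1 + c) ^ i * (1 - B + 4 * c) ^ j * (c * (1 - B)) ^ k\<close> with \<open>i + 2 * j + 3 * k = n\<close>.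

  On the conic \<open>B = c * (2 - c)\<close> the second factor is the square of the first, so \<open>W\<close> becomes
  \<open>(1 + c) ^ n\<close> times a polynomial of degree at most \<open>m = n div 3\<close> in
  \<open>J = c * (1 - c)\<^sup>2 / (1 + c) ^ 3\<close>. For an extremal code it is \<open>1 + O(c ^ (m + 1))\<close>, which determines
  it. The next two coefficients, computed by taking residues, are incompatible with nonnegative
  numbers of words as soon as \<open>m \<ge> 5 + n mod 3\<close>. The remaining lengths 9, 12, 13, 16, 17, 20 are
  excluded by linear programming over all relations between the numbers of words.

  For existence, the words \<open>(x, A x)\<close> form a self-dual code for each symmetric binary matrix \<open>A\<close>, and
  adjacency matrices of suitable graphs give extremal even codes.
\<close>

section \<open>The MacWilliams identity\<close>

lemma UNIV_kleinian: "UNIV = {0, k_one, k_om, k_ombar}"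
  using kleinian_cases by blast

lemma finite_UNIV_kleinian [simp]: "finite (UNIV :: kleinian set)"
  by (simp add: UNIV_kleinian)

lemma sum_kleinian: "(\<Sum>v\<in>UNIV. f v) = f 0 + f k_one + f k_om + f k_ombar"
  for f :: "kleinian \<Rightarrow> real"
  by (simp add: UNIV_kleinian zero_prod_def)

text \<open>\<open>qform (a, b) = a * b\<close>, and the polarisation of this quadratic form is the
  standard symplectic form.\<close>

lemma dot_simps [simp]: "dot (a, b) (c, d) = a * d + b * c"
  by (cases a; cases b; cases c; cases d)
     (simp_all add: dot_def qform_def norm2_def zero_prod_def)

lemma dot_add_right: "dot x (y + z) = dot x y + dot x z"
  by (cases x; cases y; cases z) (simp only: dot_simps add_Pair distrib_left ac_simps)

lemma dot_commute: "dot x y = dot y x"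
  by (cases x; cases y) (simp only: dot_simps ac_simps)

lemma dot_add_left: "dot (x + y) z = dot x z + dot y z"
  by (simp only: dot_commute[of _ z] dot_add_right)

lemma dot_0 [simp]: "dot 0 x = 0" "dot x 0 = 0"
  by (cases x; simp add: zero_prod_def)+

lemma carrier_words: "carrier (words n) = {..<n} \<rightarrow>\<^sub>E UNIV"
  by (simp add: words_def klein_group_def)

lemma mult_words: "x \<otimes>\<^bsub>words n\<^esub> y = (\<lambda>i\<in>{..<n}. x i + y i)"
  by (simp add: words_def klein_group_def)

lemma one_words: "\<one>\<^bsub>words n\<^esub> = (\<lambda>i\<in>{..<n}. 0)"
  by (simp add: words_def klein_group_def)

lemma eq_one_words:
  assumes "x \<in> carrier (words n)" "\<And>i. i < n \<Longrightarrow> x i = 0"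
  shows "x = \<one>\<^bsub>words n\<^esub>"
proof
  fix i
  show "x i = \<one>\<^bsub>words n\<^esub> i"
    using assms(2)[of i] PiE_arb[of x "{..<n}" "\<lambda>_. UNIV" i] assms(1)
    by (cases "i < n") (simp_all add: one_words carrier_words)
qed

lemma finite_words [simp]: "finite (carrier (words n))"
  by (simp add: carrier_words finite_PiE)

lemma scalar_product_commute: "scalar_product n x y = scalar_product n y x"
  by (simp only: scalar_product_def dot_commute)

lemma scalar_product_mult_left:
  "scalar_product n (x \<otimes>\<^bsub>words n\<^esub> y) z = scalar_product n x z + scalar_product n y z"
proof -
  have "scalar_product n (x \<otimes>\<^bsub>words n\<^esub> y) z = (\<Sum>i<n. dot (x i) (z i) + dot (y i) (z i))"
    unfolding scalar_product_def by (rule sum.cong) (simp_all only: mult_words dot_add_left restrict_apply' lessThan_iff)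
  then show ?thesis by (simp only: scalar_product_def sum.distrib)
qed

text \<open>The nontrivial additive character of the field with two elements.\<close>

definition sgn_bit :: "bit \<Rightarrow> real" where
  "sgn_bit b = (if b = 0 then 1 else -1)"

lemma sgn_bit_0 [simp]: "sgn_bit 0 = 1"
  and sgn_bit_1 [simp]: "sgn_bit 1 = -1"
  by (simp_all add: sgn_bit_def)

lemma sgn_bit_add: "sgn_bit (a + b) = sgn_bit a * sgn_bit b"
  by (cases a; cases b) (simp_all add: sgn_bit_def)

lemma sgn_bit_sum: "sgn_bit (\<Sum>i\<in>A. f i) = (\<Prod>i\<in>A. sgn_bit (f i))"
proof (induction A rule: infinite_finite_induct)
  case (insert x F)
  then show ?case by (simp only: sum.insert prod.insert sgn_bit_add not_False_eq_True)
qed simp_all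

text \<open>Orthogonality of characters: if some \<open>c\<close> in \<open>C\<close> has product 1
  with \<open>y\<close>, translation by \<open>c\<close> changes the sign of every term, so the sum
  equals its own negative.\<close>

lemma character_sum:
  assumes C: "L_code n C"
  shows "(\<Sum>x\<in>C. sgn_bit (scalar_product n x y)) =
         (if \<forall>x\<in>C. scalar_product n x y = 0 then real (card C) else 0)"
proof (cases "\<forall>x\<in>C. scalar_product n x y = 0")
  case False
  then obtain c where c: "c \<in> C" "scalar_product n c y = 1"
    by auto
  interpret W: group "words n" by (rule group_words)
  interpret S: subgroup C "words n" using C by (simp add: L_code_def)
  have bij: "bij_betw (\<lambda>x. c \<otimes>\<^bsub>words n\<^esub> x) C C"
    by (rule bij_betw_byWitness[where f' = "\<lambda>x. inv\<^bsub>words n\<^esub> c \<otimes>\<^bsub>words n\<^esub> x"])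
       (use c(1) in \<open>auto simp flip: W.m_assoc\<close>)
  have "(\<Sum>x\<in>C. sgn_bit (scalar_product n x y)) =
        (\<Sum>x\<in>C. sgn_bit (scalar_product n (c \<otimes>\<^bsub>words n\<^esub> x) y))"
    by (rule sum.reindex_bij_betw[OF bij, symmetric])
  also have "\<dots> = - (\<Sum>x\<in>C. sgn_bit (scalar_product n x y))"
    by (simp only: scalar_product_mult_left sgn_bit_add c(2) sgn_bit_1 mult_minus_left mult_1 sum_negf)
  finally show ?thesis unfolding if_not_P[OF False] by simp
qed simp

definition fourier :: "(kleinian \<Rightarrow> real) \<Rightarrow> kleinian \<Rightarrow> real" where
  "fourier f u = (\<Sum>v\<in>UNIV. sgn_bit (dot u v) * f v)"

text \<open>Poisson summation: expanding the product of local transforms gives a sum over all words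
  \<open>y\<close>, and summing the characters over \<open>C\<close> first leaves only the
  \<open>y\<close> in the dual.\<close>

theorem macwilliams:
  assumes C: "L_code n C"
  shows "(\<Sum>x\<in>C. \<Prod>i<n. fourier f (x i)) = real (card C) * (\<Sum>y\<in>dual n C. \<Prod>i<n. f (y i))"
proof -
  have "(\<Sum>x\<in>C. \<Prod>i<n. fourier f (x i)) =
        (\<Sum>x\<in>C. \<Sum>y\<in>carrier (words n). sgn_bit (scalar_product n x y) * (\<Prod>i<n. f (y i)))"
    unfolding fourier_def carrier_words
    by (simp add: prod_sum_PiE prod.distrib scalar_product_def sgn_bit_sum)
  also have "\<dots> = (\<Sum>y\<in>carrier (words n). (\<Sum>x\<in>C. sgn_bit (scalar_product n x y)) * (\<Prod>i<n. f (y i)))"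
    by (subst sum.swap) (simp add: sum_distrib_right)
  also have "\<dots> = (\<Sum>y\<in>carrier (words n). if y \<in> dual n C then real (card C) * (\<Prod>i<n. f (y i)) else 0)"
  proof (rule sum.cong)
    fix y assume "y \<in> carrier (words n)"
    then have "y \<in> dual n C \<longleftrightarrow> (\<forall>x\<in>C. scalar_product n x y = 0)"
      by (simp only: dual_def mem_Collect_eq scalar_product_commute[of n y] simp_thms)
    then show "(\<Sum>x\<in>C. sgn_bit (scalar_product n x y)) * (\<Prod>i<n. f (y i)) =
               (if y \<in> dual n C then real (card C) * (\<Prod>i<n. f (y i)) else 0)"
      by (simp only: character_sum[OF C]) simp
  qed simp
  also have "\<dots> = (\<Sum>y\<in>dual n C. real (card C) * (\<Prod>i<n. f (y i)))"
    by (rule sum.inter_filter[symmetric, THEN trans]) (auto simp: dual_def intro!: sum.cong)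
  finally show ?thesis by (simp add: sum_distrib_left)
qed

lemma fourier_simps:
  "fourier f 0 = f 0 + f k_one + f k_om + f k_ombar"
  "fourier f k_one = f 0 + f k_one - f k_om - f k_ombar"
  "fourier f k_om = f 0 - f k_one + f k_om - f k_ombar"
  "fourier f k_ombar = f 0 - f k_one - f k_om + f k_ombar"
  by (simp_all add: fourier_def sum_kleinian)

text \<open>The constant function 1 has transform 4 at \<open>0\<close> and 0 elsewhere, so the
  MacWilliams identity becomes \<open>4 ^ n = (card C)^2\<close>.\<close>

lemma card_self_dual:
  assumes C: "L_code n C" and sd: "self_dual n C"
  shows "real (card C) = 2 ^ n"
proof -
  have one: "\<one>\<^bsub>words n\<^esub> \<in> C"
    using C by (simp add: L_code_def subgroup.one_closed)
  have fin: "finite C"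
    using C finite_words by (metis L_code_def finite_subset subgroup.subset)
  have f: "fourier (\<lambda>_. 1) u = (if u = 0 then 4 else 0)" for u
    using kleinian_cases[of u]
    by (elim disjE; simp only: fourier_simps; simp add: zero_prod_def)
  have *: "(\<Prod>i<n. fourier (\<lambda>_. 1) (x i)) = (if x = \<one>\<^bsub>words n\<^esub> then 4 ^ n else 0)" if "x \<in> C" for x
  proof (cases "x = \<one>\<^bsub>words n\<^esub>")
    case False
    have "x \<in> carrier (words n)" using that C by (metis L_code_def subgroup.mem_carrier)
    then have "\<exists>i<n. x i \<noteq> 0" using False eq_one_words by blast
    then show ?thesis using False by (auto simp: f)
  qed (simp add: f one_words)
  have "(4::real) ^ n = (\<Sum>x\<in>C. \<Prod>i<n. fourier (\<lambda>_. 1) (x i))"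
    using one fin by (simp add: * sum.delta)
  also have "\<dots> = real (card C) * real (card C)"
    using sd by (simp add: macwilliams[OF C] self_dual_def flip: sd[unfolded self_dual_def])
  finally have "(2 ^ n)\<^sup>2 = (real (card C))\<^sup>2"
    by (simp add: power2_eq_square flip: power_mult_distrib)
  then show ?thesis by (simp add: power2_eq_iff_nonneg)
qed

section \<open>The symmetrized weight enumerator\<close>

definition val :: "real \<Rightarrow> real \<Rightarrow> real \<Rightarrow> kleinian \<Rightarrow> real" where
  "val a b c x = (if x = 0 then a else if x = k_one then b else c)"

definition enum :: "nat \<Rightarrow> (nat \<Rightarrow> kleinian) set \<Rightarrow> real \<Rightarrow> real \<Rightarrow> real \<Rightarrow> real" where
  "enum n C a b c = (\<Sum>x\<in>C. \<Prod>i<n. val a b c (x i))"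

definition num1 :: "nat \<Rightarrow> (nat \<Rightarrow> kleinian) \<Rightarrow> nat" where
  "num1 n x = card {i. i < n \<and> x i = k_one}"

definition num2 :: "nat \<Rightarrow> (nat \<Rightarrow> kleinian) \<Rightarrow> nat" where
  "num2 n x = card {i. i < n \<and> x i \<noteq> 0 \<and> x i \<noteq> k_one}"

lemma num_le: "num1 n x + num2 n x \<le> n"
proof -
  have "num1 n x + num2 n x = card ({i. i < n \<and> x i = k_one} \<union> {i. i < n \<and> x i \<noteq> 0 \<and> x i \<noteq> k_one})"
    unfolding num1_def num2_def by (subst card_Un_disjoint) auto
  also have "\<dots> \<le> card {..<n}" by (intro card_mono) auto
  finally show ?thesis by simp
qed

lemma num_Suc:
  "num1 (Suc n) x = num1 n x + (if x n = k_one then 1 else 0)"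
  "num2 (Suc n) x = num2 n x + (if x n \<noteq> 0 \<and> x n \<noteq> k_one then 1 else 0)"
proof -
  have "{i. i < Suc n \<and> P i} = (if P n then insert n {i. i < n \<and> P i} else {i. i < n \<and> P i})" for P
    by (auto simp: less_Suc_eq)
  then show "num1 (Suc n) x = num1 n x + (if x n = k_one then 1 else 0)"
    "num2 (Suc n) x = num2 n x + (if x n \<noteq> 0 \<and> x n \<noteq> k_one then 1 else 0)"
    by (auto simp: num1_def num2_def)
qed

lemma prod_val:
  "(\<Prod>i<n. val a b c (x i)) = a ^ (n - num1 n x - num2 n x) * b ^ num1 n x * c ^ num2 n x"
proof (induction n)
  case (Suc n)
  then show ?case using num_le[of n x]
    by (auto simp: num_Suc val_def Suc_diff_le zero_prod_def)
qed (simp add: num1_def num2_def)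

lemma ewt_num: "ewt n x = num1 n x + 2 * num2 n x"
proof (induction n)
  case (Suc n)
  then have "ewt (Suc n) x = num1 n x + 2 * num2 n x + norm2 (x n)"
    by (simp add: ewt_def)
  then show ?case by (simp add: num_Suc norm2_def zero_prod_def)
qed (simp add: num1_def num2_def ewt_def)

lemma fourier_val:
  "fourier (val a b c) = val (a + b + 2 * c) (a + b - 2 * c) (a - b)"
proof
  fix u
  show "fourier (val a b c) u = val (a + b + 2 * c) (a + b - 2 * c) (a - b) u"
    using kleinian_cases[of u]
    by (elim disjE; simp only: fourier_simps; simp add: val_def zero_prod_def)
qed

lemma enum_scale: "enum n C (t * a) (t * b) (t * c) = t ^ n * enum n C a b c"
proof -
  have "val (t * a) (t * b) (t * c) x = t * val a b c x" for x
    by (simp add: val_def)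
  then show ?thesis by (simp add: enum_def prod.distrib sum_distrib_left)
qed

text \<open>
  In these coordinates evenness of the code exchanges \<open>x\<close> and \<open>y\<close>, and the MacWilliams
  identity exchanges \<open>y\<close> and \<open>z\<close>.
\<close>

definition tenum :: "nat \<Rightarrow> (nat \<Rightarrow> kleinian) set \<Rightarrow> real \<Rightarrow> real \<Rightarrow> real \<Rightarrow> real" where
  "tenum n C x y z = enum n C (x + y) (x - y) z"

text \<open>Exchanging \<open>x\<close> and \<open>y\<close> negates the variable of the letter
  \<open>1\<close>, which occurs an even number of times in each word because
  \<open>ewt = num1 + 2 * num2\<close>.\<close>

lemma tenum_swap12:
  assumes "even_code n C"
  shows "tenum n C y x z = tenum n C x y z"
  unfolding tenum_def enum_def
proof (rule sum.cong)
  fix w assume "w \<in> C"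
  then have "even (num1 n w)"
    using assms ewt_num[of n w] unfolding even_code_def by (metis dvd_add_left_iff dvd_triv_left)
  then have "(y - x) ^ num1 n w = (x - y) ^ num1 n w"
    by (metis minus_diff_eq power_minus_even)
  then show "(\<Prod>i<n. val (y + x) (y - x) z (w i)) = (\<Prod>i<n. val (x + y) (x - y) z (w i))"
    by (simp add: prod_val add.commute)
qed simp

text \<open>The transform of \<open>val (x + y) (x - y) z\<close> is
  \<open>val (2 * (x + z)) (2 * (x - z)) (2 * y)\<close>; the resulting \<open>2 ^ n\<close> cancels
  against the size of the code.\<close>

lemma tenum_swap23:
  assumes C: "L_code n C" and sd: "self_dual n C"
  shows "tenum n C x z y = tenum n C x y z"
proof -
  have d: "dual n C = C" using sd by (simp add: self_dual_def)
  have "2 ^ n * tenum n C x z y = enum n C (2 * (x + z)) (2 * (x - z)) (2 * y)"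
    by (simp only: enum_scale tenum_def)
  also have "\<dots> = (\<Sum>w\<in>C. \<Prod>i<n. fourier (val (x + y) (x - y) z) (w i))"
    by (simp add: enum_def fourier_val algebra_simps)
  also have "\<dots> = 2 ^ n * tenum n C x y z"
    by (simp add: macwilliams[OF C] card_self_dual[OF C sd] d tenum_def enum_def)
  finally show ?thesis by simp
qed

section \<open>Symmetric forms\<close>

text \<open>\<open>form n\<close> describes the homogeneous polynomial functions of degree
  \<open>n\<close>, \<open>sform n\<close> those expressed in the elementary symmetric functions.
  Both are predicates on functions, so polynomial identities can be used as plain equations.\<close>

inductive form :: "nat \<Rightarrow> (real \<Rightarrow> real \<Rightarrow> real \<Rightarrow> real) \<Rightarrow> bool" where
  form_const: "form 0 (\<lambda>x y z. r)"
| form_x: "form n f \<Longrightarrow> form (Suc n) (\<lambda>x y z. x * f x y z)"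
| form_y: "form n f \<Longrightarrow> form (Suc n) (\<lambda>x y z. y * f x y z)"
| form_z: "form n f \<Longrightarrow> form (Suc n) (\<lambda>x y z. z * f x y z)"
| form_add: "form n f \<Longrightarrow> form n g \<Longrightarrow> form n (\<lambda>x y z. f x y z + g x y z)"

inductive sform :: "nat \<Rightarrow> (real \<Rightarrow> real \<Rightarrow> real \<Rightarrow> real) \<Rightarrow> bool" where
  sform_const: "sform 0 (\<lambda>x y z. r)"
| sform_e1: "sform n f \<Longrightarrow> sform (n + 1) (\<lambda>x y z. (x + y + z) * f x y z)"
| sform_e2: "sform n f \<Longrightarrow> sform (n + 2) (\<lambda>x y z. (x * y + y * z + z * x) * f x y z)"
| sform_e3: "sform n f \<Longrightarrow> sform (n + 3) (\<lambda>x y z. (x * y * z) * f x y z)"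
| sform_add: "sform n f \<Longrightarrow> sform n g \<Longrightarrow> sform n (\<lambda>x y z. f x y z + g x y z)"

lemma sform_scale:
  assumes "sform n f"
  shows "sform n (\<lambda>x y z. r * f x y z)"
  using assms
proof induction
  case (sform_const s)
  show ?case by (rule sform.sform_const)
next
  case (sform_e1 n f)
  then show ?case using sform.sform_e1[OF sform_e1.IH] by (simp add: mult.left_commute)
next
  case (sform_e2 n f)
  then show ?case using sform.sform_e2[OF sform_e2.IH] by (simp add: mult.left_commute)
next
  case (sform_e3 n f)
  then show ?case using sform.sform_e3[OF sform_e3.IH] by (simp add: mult.left_commute)
next
  case (sform_add n f g)
  then show ?case using sform.sform_add[OF sform_add.IH] by (simp add: distrib_left)
qed

lemma sform_mult:
  assumes "sform m f" "sform n g"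
  shows "sform (m + n) (\<lambda>x y z. f x y z * g x y z)"
  using assms
proof induction
  case (sform_const s)
  then show ?case by (simp add: sform_scale)
next
  case (sform_e1 m f)
  have "m + 1 + n = m + n + 1" by simp
  then show ?case using sform.sform_e1[OF sform_e1.IH[OF sform_e1.prems]]
    by (simp only: mult.assoc)
next
  case (sform_e2 m f)
  have "m + 2 + n = m + n + 2" by simp
  then show ?case using sform.sform_e2[OF sform_e2.IH[OF sform_e2.prems]]
    by (simp only: mult.assoc)
next
  case (sform_e3 m f)
  have "m + 3 + n = m + n + 3" by simp
  then show ?case using sform.sform_e3[OF sform_e3.IH[OF sform_e3.prems]]
    by (simp only: mult.assoc)
next
  case (sform_add m f h)
  then show ?case using sform.sform_add[OF sform_add.IH] by (simp only: distrib_right)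
qed

text \<open>Newton's recurrence
  \<open>p (k + 3) = e1 * p (k + 2) - e2 * p (k + 1) + e3 * p k\<close>, started with
  \<open>p 2 = e1^2 - 2 * e2\<close>.\<close>

lemma sform_power_sum: "sform n (\<lambda>x y z. x ^ n + y ^ n + z ^ n)"
proof (induction n rule: less_induct)
  case (less n)
  consider "n = 0" | "n = 1" | "n = 2" | "n = (n - 3) + 3"
    by linarith
  then show ?case
  proof cases
    case 1
    then show ?thesis using sform_const[of 3] by simp
  next
    case 2
    then show ?thesis using sform_e1[OF sform_const[of 1]] by simp
  next
    case 3
    have e1: "sform 1 (\<lambda>x y z. x + y + z)"
      using sform_e1[OF sform_const[of 1]] by simp
    have e2: "sform (1 + 1) (\<lambda>x y z. x * y + y * z + z * x)"
      using sform_e2[OF sform_const[of 1]] by (simp add: numeral_2_eq_2)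
    have "sform (1 + 1) (\<lambda>x y z. (x + y + z) * (x + y + z) + (-2) * (x * y + y * z + z * x))"
      by (intro sform_add sform_mult sform_scale e1 e2)
    then show ?thesis using 3 by (simp add: algebra_simps power2_eq_square numeral_2_eq_2)
  next
    case 4
    define k where "k = n - 3"
    have 4: "n = k + 3" using 4 by (simp add: k_def)
    let ?p = "\<lambda>i x y z. x ^ i + y ^ i + z ^ i :: real"
    have 1: "sform n (\<lambda>x y z. (x + y + z) * ?p (k + 2) x y z)"
      using sform_e1[OF less.IH[of "k + 2"]] 4 by (simp add: numeral_eq_Suc)
    have 2: "sform n (\<lambda>x y z. (x * y + y * z + z * x) * ?p (k + 1) x y z)"
      using sform_e2[OF less.IH[of "k + 1"]] 4 by (simp add: numeral_eq_Suc)
    have 3: "sform n (\<lambda>x y z. x * y * z * ?p k x y z)"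
      using sform_e3[OF less.IH[of k]] 4 by simp
    have "sform n (\<lambda>x y z. (x + y + z) * ?p (k + 2) x y z
        + ((-1) * ((x * y + y * z + z * x) * ?p (k + 1) x y z) + x * y * z * ?p k x y z))"
      by (intro sform_add sform_scale 1 2 3)
    then show ?thesis unfolding 4 by (simp add: algebra_simps power_add eval_nat_numeral)
  qed
qed

definition symz :: "(real \<Rightarrow> real \<Rightarrow> real \<Rightarrow> real) \<Rightarrow> real \<Rightarrow> real \<Rightarrow> real \<Rightarrow> real" where
  "symz f x y z = f x y z + f y z x + f z x y + f y x z + f z y x + f x z y"

text \<open>In the product of two power sums, the terms that use one variable twice form the power
  sum of exponent \<open>i + j\<close>; the remaining ones form the symmetrization.\<close>

lemma sform_symz_two: "sform (i + j) (symz (\<lambda>x y z. x ^ i * y ^ j))"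
proof -
  have "sform (i + j) (\<lambda>x y z. (x ^ i + y ^ i + z ^ i) * (x ^ j + y ^ j + z ^ j)
      + (-1) * (x ^ (i + j) + y ^ (i + j) + z ^ (i + j)))"
    by (intro sform_add sform_mult sform_scale sform_power_sum)
  also have "(\<lambda>x y z. (x ^ i + y ^ i + z ^ i) * (x ^ j + y ^ j + z ^ j)
      + (-1) * (x ^ (i + j) + y ^ (i + j) + z ^ (i + j))) = symz (\<lambda>x y z. x ^ i * y ^ j)"
    by (simp add: symz_def fun_eq_iff algebra_simps power_add)
  finally show ?thesis .
qed

lemma sform_e3_power: "sform n f \<Longrightarrow> sform (n + 3 * k) (\<lambda>x y z. (x * y * z) ^ k * f x y z)"
proof (induction k)
  case (Suc k)
  then show ?case using sform_e3[of "n + 3 * k"] by (simp add: mult.assoc add_ac)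
qed simp

text \<open>The smallest exponent splits off as a power of \<open>x * y * z\<close>, which leaves a
  monomial in two variables.\<close>

lemma sform_symz_monomial: "sform (i + j + k) (symz (\<lambda>x y z. x ^ i * y ^ j * z ^ k))"
proof -
  have last: "sform (i + j + k) (symz (\<lambda>x y z. x ^ i * y ^ j * z ^ k))"
    if "k \<le> i" "k \<le> j" for i j k
  proof -
    define p q where "p = i - k" and "q = j - k"
    then have pq: "i = p + k" "j = q + k"
      using that by simp_all
    have "sform (p + q + 3 * k) (\<lambda>x y z. (x * y * z) ^ k * symz (\<lambda>x y z. x ^ p * y ^ q) x y z)"
      by (intro sform_e3_power sform_symz_two)
    also have "(\<lambda>x y z. (x * y * z) ^ k * symz (\<lambda>x y z. x ^ p * y ^ q) x y z) =
        symz (\<lambda>x y z. x ^ i * y ^ j * z ^ k)"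
    proof (intro ext)
      fix x y z :: real
      have t: "(u * v * w) ^ k * (u ^ p * v ^ q) = u ^ i * v ^ j * w ^ k" for u v w :: real
        by (simp add: pq power_add power_mult_distrib mult_ac)
      have "y * z * x = x * y * z" "z * x * y = x * y * z" "y * x * z = x * y * z"
        "z * y * x = x * y * z" "x * z * y = x * y * z"
        by (simp_all add: mult_ac)
      with t[of x y z] t[of y z x] t[of z x y] t[of y x z] t[of z y x] t[of x z y]
      show "(x * y * z) ^ k * symz (\<lambda>x y z. x ^ p * y ^ q) x y z = symz (\<lambda>x y z. x ^ i * y ^ j * z ^ k) x y z"
        by (simp only: symz_def distrib_left)
    qed
    finally show ?thesis by (simp add: pq add_ac mult.commute[of k] numeral_eq_Suc)
  qed
  consider "k \<le> i" "k \<le> j" | "i \<le> j" "i \<le> k" | "j \<le> i" "j \<le> k"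
    by linarith
  then show ?thesis
  proof cases
    case 1
    then show ?thesis by (rule last)
  next
    case 2
    have "symz (\<lambda>x y z. x ^ j * y ^ k * z ^ i) = symz (\<lambda>x y z. x ^ i * y ^ j * z ^ k)"
      by (simp add: symz_def fun_eq_iff mult_ac)
    then show ?thesis using last[OF 2] by (simp add: add_ac)
  next
    case 3
    have "symz (\<lambda>x y z. x ^ i * y ^ k * z ^ j) = symz (\<lambda>x y z. x ^ i * y ^ j * z ^ k)"
      by (simp add: symz_def fun_eq_iff mult_ac)
    then show ?thesis using last[OF 3] by (simp add: add_ac)
  qed
qed

text \<open>The induction peels variables off the form; the extra monomial stores those already
  removed.\<close>

lemma sform_symz:
  assumes "form n f"
  shows "sform (n + i + j + k) (symz (\<lambda>x y z. x ^ i * y ^ j * z ^ k * f x y z))"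
  using assms
proof (induction arbitrary: i j k)
  case (form_const r)
  have "symz (\<lambda>x y z. x ^ i * y ^ j * z ^ k * r) =
      (\<lambda>x y z. r * symz (\<lambda>x y z. x ^ i * y ^ j * z ^ k) x y z)"
    by (simp add: symz_def fun_eq_iff algebra_simps)
  then show ?case by (simp add: sform_scale sform_symz_monomial)
next
  case (form_x n f)
  show ?case using form_x.IH[of "Suc i" j k] by (simp add: mult_ac)
next
  case (form_y n f)
  show ?case using form_y.IH[of i "Suc j" k] by (simp add: mult_ac)
next
  case (form_z n f)
  show ?case using form_z.IH[of i j "Suc k"] by (simp add: mult_ac)
next
  case (form_add n f g)
  have "symz (\<lambda>x y z. x ^ i * y ^ j * z ^ k * (f x y z + g x y z)) =
      (\<lambda>x y z. symz (\<lambda>x y z. x ^ i * y ^ j * z ^ k * f x y z) x y z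
             + symz (\<lambda>x y z. x ^ i * y ^ j * z ^ k * g x y z) x y z)"
    by (simp add: symz_def fun_eq_iff algebra_simps)
  then show ?case by (simp add: sform_add form_add.IH)
qed

text \<open>The two assumed transpositions generate all permutations, so symmetrizing multiplies the
  form by 6.\<close>

theorem symmetric_form_is_sform:
  assumes f: "form n f" and "\<And>x y z. f y x z = f x y z" "\<And>x y z. f x z y = f x y z"
  shows "sform n f"
proof -
  have "symz f = (\<lambda>x y z. 6 * f x y z)"
  proof (intro ext)
    fix x y z
    have "f y z x = f x y z" "f z x y = f x y z" "f y x z = f x y z" "f z y x = f x y z" "f x z y = f x y z"
      using assms(2,3) by metis+
    then show "symz f x y z = 6 * f x y z" by (simp add: symz_def)
  qed
  then have "sform n (\<lambda>x y z. 6 * f x y z)"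
    using sform_symz[OF f, of 0 0 0] by simp
  from sform_scale[OF this, of "1 / 6"] show ?thesis by simp
qed

section \<open>The enumerator as a symmetric form\<close>

lemma form_zero: "form n (\<lambda>x y z. 0)"
proof (induction n)
  case (Suc n)
  then show ?case using form_x by fastforce
qed (rule form_const)

lemma form_sum: "(\<And>i. i \<in> A \<Longrightarrow> form n (f i)) \<Longrightarrow> form n (\<lambda>x y z. \<Sum>i\<in>A. f i x y z)"
  by (induction A rule: infinite_finite_induct) (simp_all add: form_zero form_add)

lemma form_scale:
  assumes "form n f"
  shows "form n (\<lambda>x y z. r * f x y z)"
  using assms
proof induction
  case (form_const s)
  show ?case by (rule form.form_const)
next
  case (form_x n f)
  then show ?case using form.form_x[OF form_x.IH] by (simp add: mult.left_commute)
next
  case (form_y n f)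
  then show ?case using form.form_y[OF form_y.IH] by (simp add: mult.left_commute)
next
  case (form_z n f)
  then show ?case using form.form_z[OF form_z.IH] by (simp add: mult.left_commute)
next
  case (form_add n f g)
  then show ?case using form.form_add[OF form_add.IH] by (simp add: distrib_left)
qed

lemma form_prod_val: "form n (\<lambda>x y z. \<Prod>i<n. val (x + y) (x - y) z (w i))"
proof (induction n)
  case (Suc n)
  let ?f = "\<lambda>x y z. \<Prod>i<n. val (x + y) (x - y) z (w i)"
  consider "w n = 0" | "w n = k_one" | "w n \<noteq> 0" "w n \<noteq> k_one" by blast
  then show ?case
  proof cases
    case 1
    then show ?thesis
      using form_add[OF form_x[OF Suc] form_y[OF Suc]] by (simp add: val_def algebra_simps)
  next
    case 2
    have "form (Suc n) (\<lambda>x y z. x * ?f x y z + (-1) * (y * ?f x y z))"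
      by (intro form_add form_x form_y form_scale Suc)
    then show ?thesis using 2 by (simp add: val_def algebra_simps zero_prod_def)
  next
    case 3
    then show ?thesis using form_z[OF Suc] by (simp add: val_def algebra_simps)
  qed
qed (simp add: form_const)

theorem sform_tenum:
  assumes "L_code n C" "even_code n C" "self_dual n C"
  shows "sform n (tenum n C)"
proof (rule symmetric_form_is_sform)
  show "form n (tenum n C)"
    unfolding tenum_def enum_def by (intro form_sum form_prod_val)
qed (use assms tenum_swap12 tenum_swap23 in auto)

text \<open>The strengthened claim multiplies \<open>f\<close> by a monomial in the elementary
  symmetric functions that collects the generators met on the way down.\<close>

lemma sform_span_induct [consumes 1, case_names monomial add]:
  assumes f: "sform n f"
    and monomial: "\<And>r i j k. i + 2 * j + 3 * k = n \<Longrightarrow>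
      P (\<lambda>x y z. r * (x + y + z) ^ i * (x * y + y * z + z * x) ^ j * (x * y * z) ^ k)"
    and add: "\<And>f g. P f \<Longrightarrow> P g \<Longrightarrow> P (\<lambda>x y z. f x y z + g x y z)"
  shows "P f"
proof -
  have "P (\<lambda>x y z. (x + y + z) ^ i * (x * y + y * z + z * x) ^ j * (x * y * z) ^ k * f x y z)"
    if "sform m f" "m + i + 2 * j + 3 * k = n" for m f i j k
    using that
  proof (induction arbitrary: i j k)
    case (sform_const r)
    then show ?case using monomial[of i j k r] by (simp add: mult_ac)
  next
    case (sform_e1 m f)
    then show ?case using sform_e1.IH[of "Suc i" j k] by (simp add: mult_ac)
  next
    case (sform_e2 m f)
    then show ?case using sform_e2.IH[of i "Suc j" k] by (simp add: mult_ac)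
  next
    case (sform_e3 m f)
    then show ?case using sform_e3.IH[of i j "Suc k"] by (simp add: mult_ac)
  next
    case (sform_add m f g)
    then show ?case using add by (simp add: distrib_left)
  qed
  from this[OF f, of 0 0 0] show ?thesis by simp
qed

section \<open>The enumerator as a polynomial in \<open>B\<close> and \<open>c\<close>\<close>

text \<open>The outer variable is \<open>B\<close>, the inner one \<open>c\<close>.\<close>

abbreviation ev :: "real poly poly \<Rightarrow> real \<Rightarrow> real \<Rightarrow> real" where
  "ev q B c \<equiv> poly (poly q [:B:]) c"

text \<open>For fixed \<open>c\<close> the polynomial in \<open>B\<close> has infinitely many roots.
  Only nonnegative \<open>B\<close> are at hand, since \<open>B\<close> will be the square of a real
  \<open>b\<close>.\<close>

lemma ev_eq_0_imp:
  assumes "\<And>B c. B \<ge> 0 \<Longrightarrow> ev q B c = 0"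
  shows "q = 0"
proof (rule poly_eqI)
  fix r
  have "poly (coeff q r) c = 0" for c
  proof -
    let ?p = "map_poly (\<lambda>u. poly u c) q"
    have "poly ?p B = ev q B c" for B
      by (induction q) (simp_all add: map_poly_pCons)
    then have "{0..} \<subseteq> {B. poly ?p B = 0}"
      using assms by auto
    then have "infinite {B. poly ?p B = 0}"
      using infinite_Ici finite_subset by blast
    then have "?p = 0"
      using poly_roots_finite by blast
    then have "coeff ?p r = 0" by simp
    then show ?thesis by (simp add: coeff_map_poly)
  qed
  then have "coeff q r = 0" by (intro poly_all_0_iff_0[THEN iffD1]) blast
  then show "coeff q r = coeff 0 r" by simp
qed

text \<open>Here \<open>a = 1\<close>. In an even code \<open>num1\<close> is even, so halving it
  gives exactly the exponent of \<open>B = b^2\<close>.\<close>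

definition enum_poly :: "nat \<Rightarrow> (nat \<Rightarrow> kleinian) set \<Rightarrow> real poly poly" where
  "enum_poly n C = (\<Sum>x\<in>C. monom (monom 1 (num2 n x)) (num1 n x div 2))"

lemma even_num1: "even_code n C \<Longrightarrow> x \<in> C \<Longrightarrow> even (num1 n x)"
  using ewt_num[of n x] unfolding even_code_def by (metis dvd_add_left_iff dvd_triv_left)

lemma tenum_eq_ev:
  assumes "even_code n C"
  shows "tenum n C ((1 + b) / 2) ((1 - b) / 2) c = ev (enum_poly n C) (b\<^sup>2) c"
proof -
  have "(\<Prod>i<n. val 1 b c (x i)) = (b\<^sup>2) ^ (num1 n x div 2) * c ^ num2 n x" if "x \<in> C" for x
    using even_num1[OF assms that] by (simp add: prod_val flip: power_mult)
  then show ?thesis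
    by (simp add: tenum_def enum_def enum_poly_def poly_sum poly_monom field_simps)
qed

text \<open>
  With \<open>a = 1\<close> and \<open>B = b\<^sup>2\<close> the elementary symmetric functions of \<open>(1 + b) / 2\<close>,
  \<open>(1 - b) / 2\<close>, \<open>c\<close> are \<open>1 + c\<close>, \<open>(1 - B + 4 * c) / 4\<close> and \<open>c * (1 - B) / 4\<close>.
\<close>

theorem enum_poly_induct [case_names monomial add]:
  assumes C: "L_code n C" "even_code n C" "self_dual n C"
    and monomial: "\<And>r i j k. i + 2 * j + 3 * k = n \<Longrightarrow>
      P ([:[:r:]:] * [:[:1, 1:]:] ^ i * [:[:1, 4:], -1:] ^ j * [:[:0, 1:], [:0, -1:]:] ^ k)"
    and add: "\<And>p q. P p \<Longrightarrow> P q \<Longrightarrow> P (p + q)"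
  shows "P (enum_poly n C)"
proof -
  have "\<exists>q. P q \<and> (\<forall>b c. tenum n C ((1 + b) / 2) ((1 - b) / 2) c = ev q (b\<^sup>2) c)"
    using sform_tenum[OF C]
  proof (induction rule: sform_span_induct)
    case (monomial r i j k)
    have e: "(1 + b) / 2 + (1 - b) / 2 + c = 1 + c"
      "(1 + b) / 2 * ((1 - b) / 2) + (1 - b) / 2 * c + c * ((1 + b) / 2) = (1 - b\<^sup>2 + c * 4) / 4"
      "(1 + b) / 2 * ((1 - b) / 2) * c = c * (1 - b\<^sup>2) / 4" for b c :: real
      by (simp_all add: field_simps power2_eq_square)
    \<comment> \<open>The denominators 4 of the second and third elementary symmetric functions move
      into the constant.\<close>
    let ?q = "[:[:r / 4 ^ j / 4 ^ k:]:] * [:[:1, 1:]:] ^ i * [:[:1, 4:], -1:] ^ j * [:[:0, 1:], [:0, -1:]:] ^ k"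
    show ?case
    proof (intro exI[of _ ?q] conjI allI)
      show "P ?q" using monomial assms(4) by blast
    qed (unfold e, simp add: power_divide)
  next
    case (add f g)
    then show ?case using assms(5) by (metis (no_types, lifting) poly_add)
  qed
  then obtain q where q: "P q" "\<And>b c. tenum n C ((1 + b) / 2) ((1 - b) / 2) c = ev q (b\<^sup>2) c"
    by blast
  \<comment> \<open>Both polynomials take the values of \<open>tenum\<close> at
    \<open>b = sqrt B\<close>.\<close>
  have "enum_poly n C - q = 0"
  proof (rule ev_eq_0_imp)
    fix B c :: real assume "B \<ge> 0"
    then show "ev (enum_poly n C - q) B c = 0"
      using q(2)[of "sqrt B" c] tenum_eq_ev[OF C(2), of "sqrt B" c] by simp
  qed
  then show ?thesis using q(1) by simp
qed

section \<open>Finite integer tables\<close>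

fun row_add :: "int list \<Rightarrow> int list \<Rightarrow> int list" where
  "row_add [] ys = ys"
| "row_add (x # xs) [] = x # xs"
| "row_add (x # xs) (y # ys) = (x + y) # row_add xs ys"

fun tab_add :: "int list list \<Rightarrow> int list list \<Rightarrow> int list list" where
  "tab_add [] T = T"
| "tab_add (x # xs) [] = x # xs"
| "tab_add (x # xs) (y # ys) = row_add x y # tab_add xs ys"

definition tab_scale :: "int \<Rightarrow> int list list \<Rightarrow> int list list" where
  "tab_scale a = map (map ((*) a))"

text \<open>Missing entries count as 0, so a table is a finitely supported array whatever its row
  lengths.\<close>

definition entry :: "int list list \<Rightarrow> nat \<Rightarrow> nat \<Rightarrow> int" where
  "entry T r s = nth_default 0 (nth_default [] T r) s"

lemma nth_default_row_add: "nth_default 0 (row_add xs ys) s = nth_default 0 xs s + nth_default 0 ys s"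
  by (induction xs ys arbitrary: s rule: row_add.induct)
     (auto simp: nth_default_Cons split: nat.split)

lemma row_add_Nil2 [simp]: "row_add xs [] = xs"
  by (cases xs) auto

lemma nth_default_tab_add: "nth_default [] (tab_add S T) r = row_add (nth_default [] S r) (nth_default [] T r)"
  by (induction S T arbitrary: r rule: tab_add.induct)
     (auto simp: nth_default_Cons split: nat.split)

lemma nth_default_tl: "nth_default d (tl xs) s = nth_default d xs (Suc s)"
  by (cases xs) auto

lemma entry_simps [simp]:
  "entry (tab_add S T) r s = entry S r s + entry T r s"
  "entry (tab_scale a T) r s = a * entry T r s"
  "entry (map tl T) r s = entry T r (Suc s)"
  "entry (tl T) r s = entry T (Suc r) s"
  by (simp_all add: entry_def nth_default_tab_add nth_default_row_add tab_scale_def nth_default_tl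
      nth_default_map_eq[where dflt = "[]" and dflt' = "[]"]
      nth_default_map_eq[where dflt = 0 and dflt' = 0]
      flip: nth_default_tl)

section \<open>Linear functionals on the enumerators\<close>

text \<open>
  A table \<open>T\<close> acts on polynomials in \<open>B\<close> and \<open>c\<close> by pairing \<open>entry T r s\<close> with the coefficient
  of \<open>B ^ r * c ^ s\<close>. The operations \<open>adj1\<close>, \<open>adj2\<close>, \<open>adj3\<close> are the adjoints of the multiplications
  by \<open>1 + c\<close>, \<open>1 - B + 4 * c\<close> and \<open>c * (1 - B)\<close>, so that \<open>vanish3 n T\<close> says that \<open>T\<close> kills all
  monomials of weighted degree \<open>n\<close> in these three invariants.
\<close>

definition adj1 :: "int list list \<Rightarrow> int list list" where
  "adj1 T = tab_add T (map tl T)"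

definition adj2 :: "int list list \<Rightarrow> int list list" where
  "adj2 T = tab_add T (tab_add (tab_scale 4 (map tl T)) (tab_scale (-1) (tl T)))"

definition adj3 :: "int list list \<Rightarrow> int list list" where
  "adj3 T = tab_add (map tl T) (tab_scale (-1) (map tl (tl T)))"

text \<open>Powers of \<open>1 + c\<close> do not involve \<open>B\<close>, so only row 0 matters at
  this level, and on it \<open>adj1\<close> acts as \<open>row_add xs (tl xs)\<close>.\<close>

fun vanish1 :: "nat \<Rightarrow> int list \<Rightarrow> bool" where
  "vanish1 0 xs = (nth_default 0 xs 0 = 0)"
| "vanish1 (Suc n) xs = vanish1 n (row_add xs (tl xs))"

fun vanish2 :: "nat \<Rightarrow> int list list \<Rightarrow> bool" where
  "vanish2 n T = (vanish1 n (nth_default [] T 0) \<and> (if n < 2 then True else vanish2 (n - 2) (adj2 T)))"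

fun vanish3 :: "nat \<Rightarrow> int list list \<Rightarrow> bool" where
  "vanish3 n T = (vanish2 n T \<and> (if n < 3 then True else vanish3 (n - 3) (adj3 T)))"

declare vanish2.simps [simp del] vanish3.simps [simp del]

definition fits :: "nat \<Rightarrow> int list list \<Rightarrow> bool" where
  "fits M T \<longleftrightarrow> (\<forall>r s. M \<le> r \<or> M \<le> s \<longrightarrow> entry T r s = 0)"

definition pairing :: "nat \<Rightarrow> int list list \<Rightarrow> real poly poly \<Rightarrow> real" where
  "pairing M T q = (\<Sum>r<M. \<Sum>s<M. entry T r s * coeff (coeff q r) s)"

lemma pairing_add: "pairing M T (p + q) = pairing M T p + pairing M T q"
  by (simp add: pairing_def distrib_left sum.distrib)

lemma pairing_const: "pairing M T ([:[:a:]:] * q) = a * pairing M T q"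
  by (simp add: pairing_def sum_distrib_left mult_ac)

lemma pairing_sum: "pairing M T (\<Sum>x\<in>A. f x) = (\<Sum>x\<in>A. pairing M T (f x))"
  by (induction A rule: infinite_finite_induct) (simp_all add: pairing_add, simp_all add: pairing_def)

lemma pairing_monom:
  assumes "r < M" "s < M"
  shows "pairing M T (monom (monom 1 s) r) = entry T r s"
proof -
  have "pairing M T (monom (monom 1 s) r) =
      (\<Sum>r'<M. if r = r' then (\<Sum>s'<M. if s = s' then real_of_int (entry T r' s') else 0) else 0)"
    unfolding pairing_def
    by (intro sum.cong refl, rename_tac r', case_tac "r = r'")
      (simp_all add: if_distrib[where f = "(*) _"] cong: if_cong)
  also have "\<dots> = entry T r s"
    using assms by (simp only: sum.delta' finite_lessThan lessThan_iff if_True)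
  finally show ?thesis .
qed

lemma sum_shift:
  fixes f :: "nat \<Rightarrow> real"
  assumes "f 0 = 0" "f M = 0"
  shows "(\<Sum>i<M. f i) = (\<Sum>i<M. f (Suc i))"
  using sum.lessThan_Suc_shift[of f M] assms by simp

text \<open>Multiplication by \<open>c\<close> moves coefficients one column on, so its adjoint
  drops the first column. The term at \<open>s = M\<close> brought in by reindexing vanishes because
  \<open>T\<close> fits. For \<open>B\<close> the same happens with rows.\<close>

lemma pairing_c:
  assumes "fits M T"
  shows "pairing M T ([:[:0, 1:]:] * q) = pairing M (map tl T) q"
proof -
  have "(\<Sum>s<M. entry T r s * coeff (pCons 0 (coeff q r)) s) =
        (\<Sum>s<M. entry T r (Suc s) * coeff (coeff q r) s)" for r
    using assms by (subst sum_shift) (simp_all add: fits_def)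
  then show ?thesis by (simp add: pairing_def)
qed

lemma pairing_B:
  assumes "fits M T"
  shows "pairing M T ([:0, 1:] * q) = pairing M (tl T) q"
  unfolding pairing_def
  by (subst sum_shift) (use assms in \<open>simp_all add: fits_def\<close>)

lemma fits_adj:
  assumes "fits M T"
  shows "fits M (map tl T)" "fits M (tl T)" "fits M (adj1 T)" "fits M (adj2 T)" "fits M (adj3 T)"
  using assms by (auto simp: fits_def adj1_def adj2_def adj3_def)

lemma pairing_tab_add: "pairing M (tab_add S T) q = pairing M S q + pairing M T q"
  by (simp add: pairing_def distrib_right sum.distrib)

lemma pairing_tab_scale: "pairing M (tab_scale a T) q = a * pairing M T q"
  by (simp add: pairing_def sum_distrib_left mult_ac)

lemma pairing_adj:
  assumes "fits M T"
  shows "pairing M T ([:[:1, 1:]:] * q) = pairing M (adj1 T) q"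
    and "pairing M T ([:[:1, 4:], -1:] * q) = pairing M (adj2 T) q"
    and "pairing M T ([:[:0, 1:], [:0, -1:]:] * q) = pairing M (adj3 T) q"
proof -
  note * = pairing_tab_add pairing_tab_scale pairing_add fits_adj assms
  have "[:[:1, 1:]:] * q = q + [:[:0, 1:]:] * q"
  proof -
    have "[:[:1, 1::real:]:] = 1 + [:[:0, 1:]:]" by (simp add: one_pCons)
    then show ?thesis by (simp only: distrib_right mult_1)
  qed
  then show "pairing M T ([:[:1, 1:]:] * q) = pairing M (adj1 T) q"
    by (simp only: adj1_def * pairing_c)
  have "[:[:1, 4:], -1:] * q = q + ([:[:4:]:] * ([:[:0, 1:]:] * q) + [:[:-1:]:] * ([:0, 1:] * q))"
  proof -
    have "[:[:1, 4:], -1::real poly:] = 1 + ([:[:4:]:] * [:[:0, 1:]:] + [:[:-1:]:] * [:0, 1:])"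
      by (simp add: one_pCons)
    then show ?thesis by (simp only: distrib_right mult_1 mult.assoc)
  qed
  then show "pairing M T ([:[:1, 4:], -1:] * q) = pairing M (adj2 T) q"
    by (simp only: adj2_def * pairing_c pairing_B pairing_const of_int_numeral of_int_minus of_int_1)
  have "[:[:0, 1:], [:0, -1:]:] * q = [:[:0, 1:]:] * q + [:[:-1:]:] * ([:0, 1:] * ([:[:0, 1:]:] * q))"
  proof -
    have "[:[:0, 1:], [:0, -1::real:]:] = [:[:0, 1:]:] + [:[:-1:]:] * ([:0, 1:] * [:[:0, 1:]:])"
      by (simp add: one_pCons)
    then show ?thesis by (simp only: distrib_right mult.assoc)
  qed
  then show "pairing M T ([:[:0, 1:], [:0, -1:]:] * q) = pairing M (adj3 T) q"
    by (simp only: adj3_def * pairing_c pairing_B pairing_const of_int_numeral of_int_minus of_int_1)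
qed

lemma vanish1:
  "fits M T \<Longrightarrow> vanish1 i (nth_default [] T 0) \<Longrightarrow> pairing M T ([:[:1, 1:]:] ^ i) = 0"
proof (induction i arbitrary: T)
  case 0
  have "pairing M T 1 = entry T 0 0"
  proof (cases M)
    case 0
    then show ?thesis using \<open>fits M T\<close> by (simp add: pairing_def fits_def)
  next
    case (Suc m)
    then show ?thesis using pairing_monom[of 0 M 0 T] by simp
  qed
  then show ?case using 0 by (simp add: entry_def)
next
  case (Suc i)
  have "nth_default [] (adj1 T) 0 = row_add (nth_default [] T 0) (tl (nth_default [] T 0))"
    by (simp add: adj1_def nth_default_tab_add nth_default_map_eq[where dflt = "[]" and dflt' = "[]"])
  then have "pairing M (adj1 T) ([:[:1, 1:]:] ^ i) = 0"
    using Suc.IH[of "adj1 T"] Suc.prems fits_adj(3) by simp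
  then show ?case using pairing_adj(1)[OF Suc.prems(1)] by simp
qed

lemma vanish2:
  "fits M T \<Longrightarrow> vanish2 n T \<Longrightarrow> i + 2 * j = n \<Longrightarrow>
   pairing M T ([:[:1, 1:]:] ^ i * [:[:1, 4:], -1:] ^ j) = 0"
proof (induction j arbitrary: n T)
  case 0
  then show ?case using vanish1[of M T i] by (simp add: vanish2.simps[of n])
next
  case (Suc j)
  then have "pairing M (adj2 T) ([:[:1, 1:]:] ^ i * [:[:1, 4:], -1:] ^ j) = 0"
    using Suc.IH[of "adj2 T" "n - 2"] fits_adj(4) by (simp add: vanish2.simps[of n])
  moreover have "[:[:1, 1:]:] ^ i * [:[:1, 4:], -1:] ^ Suc j =
      [:[:1, 4:], -1::real poly:] * ([:[:1, 1:]:] ^ i * [:[:1, 4:], -1:] ^ j)"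
    by (simp only: power_Suc mult_ac)
  ultimately show ?case by (simp only: pairing_adj(2)[OF Suc.prems(1)])
qed

lemma vanish3:
  "fits M T \<Longrightarrow> vanish3 n T \<Longrightarrow> i + 2 * j + 3 * k = n \<Longrightarrow>
   pairing M T ([:[:1, 1:]:] ^ i * [:[:1, 4:], -1:] ^ j * [:[:0, 1:], [:0, -1:]:] ^ k) = 0"
proof (induction k arbitrary: n T)
  case 0
  then show ?case using vanish2[of M T "i + 2 * j" i j] by (simp add: vanish3.simps[of n])
next
  case (Suc k)
  then have "pairing M (adj3 T) ([:[:1, 1:]:] ^ i * [:[:1, 4:], -1:] ^ j * [:[:0, 1:], [:0, -1:]:] ^ k) = 0"
    using Suc.IH[of "adj3 T" "n - 3"] fits_adj(5) by (simp add: vanish3.simps[of n])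
  moreover have "[:[:1, 1:]:] ^ i * [:[:1, 4:], -1:] ^ j * [:[:0, 1:], [:0, -1:]:] ^ Suc k =
      [:[:0, 1:], [:0, -1:]:] *
      ([:[:1, 1:]:] ^ i * [:[:1, 4:], -1::real poly:] ^ j * [:[:0, 1:], [:0, -1:]:] ^ k)"
    by (simp only: power_Suc mult_ac)
  ultimately show ?case by (simp only: pairing_adj(3)[OF Suc.prems(1)])
qed

lemma fits_exists: "\<exists>M\<ge>k. fits M T"
proof -
  define M where "M = k + length T + Max (insert 0 (length ` set T))"
  have "entry T r s = 0" if "M \<le> r \<or> M \<le> s" for r s
  proof (cases "r < length T")
    case True
    then have "length (T ! r) \<le> Max (insert 0 (length ` set T))"
      by (intro Max_ge) auto
    then have "length (T ! r) \<le> s"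
      using that True unfolding M_def by linarith
    then show ?thesis by (simp add: entry_def nth_default_def)
  qed (simp add: entry_def nth_default_def)
  then show ?thesis unfolding fits_def M_def by (intro exI[of _ M]) (auto simp: M_def)
qed

text \<open>\<open>T\<close> kills all products that span the possible enumerators, hence the
  enumerator itself, and the pairing with the latter is a sum over the words.\<close>

theorem sum_entry_eq_0:
  assumes "L_code n C" "even_code n C" "self_dual n C" "vanish3 n T"
  shows "(\<Sum>x\<in>C. entry T (num1 n x div 2) (num2 n x)) = 0"
proof -
  \<comment> \<open>All exponents in the enumerator are at most \<open>n\<close>, so they lie inside
    the window.\<close>
  obtain M where M: "M \<ge> n + 1" "fits M T" using fits_exists by blast
  have "pairing M T (enum_poly n C) = 0"
  proof (induction rule: enum_poly_induct[OF assms(1-3)])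
    case (1 r i j k)
    then show ?case using vanish3[OF M(2) assms(4) 1] by (simp only: mult.assoc pairing_const mult_zero_right)
  next
    case (2 p q)
    then show ?case by (simp add: pairing_add)
  qed
  moreover have "num1 n x div 2 < M" "num2 n x < M" for x
    using M(1) num_le[of n x] by linarith+
  ultimately have "(\<Sum>x\<in>C. real_of_int (entry T (num1 n x div 2) (num2 n x))) = 0"
    by (simp add: enum_poly_def pairing_sum pairing_monom)
  then show ?thesis by (metis of_int_eq_0_iff of_int_sum)
qed

section \<open>Restriction to a conic\<close>

abbreviation geom :: "real fps" where
  "geom \<equiv> inverse (1 - fps_X)"

lemma geom_mult: "(1 - fps_X) * geom = 1"
  by (simp add: inverse_mult_eq_1')

text \<open>\<open>1 - 5 * X\<close> is the numerator of the logarithmic derivative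
  \<open>(1 - 5 * X) / (X * (1 - X) * (1 + X))\<close> of
  \<open>J = X * (1 - X)^2 / (1 + X)^3\<close>.\<close>

definition kern :: "nat \<Rightarrow> nat \<Rightarrow> real fps" where
  "kern e K = (1 + fps_X) ^ e * (1 - 5 * fps_X) * geom ^ (2 * K + 1)"

text \<open>
  Up to a constant \<open>kern (3 * d - 1) d / X ^ (d + 1)\<close> is the derivative of \<open>J ^ (- d)\<close>
  for \<open>J = X * (1 - X)\<^sup>2 / (1 + X) ^ 3\<close>, so it has no residue.
\<close>

lemma kern_residue:
  assumes "d \<ge> 1"
  shows "fps_nth (kern (3 * d - 1) d) d = 0"
proof -
  \<comment> \<open>\<open>G\<close> is \<open>X^d * J^(-d)\<close>, so
    \<open>X * G' - d * G\<close> is \<open>X^(d + 1)\<close> times the derivative of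
    \<open>J^(-d)\<close>. Its coefficient at \<open>X^d\<close> cancels.\<close>
  define G :: "real fps" where "G = (1 + fps_X) ^ (3 * d) * geom ^ (2 * d)"
  obtain e where e: "3 * d = Suc e" using assms by (cases "3 * d") auto
  obtain f where f: "2 * d = Suc f" using assms by (cases "2 * d") auto
  have p: "(1 + fps_X :: real fps) ^ (3 * d) = (1 + fps_X) * (1 + fps_X) ^ e"
    by (simp only: e power_Suc)
  have dg: "fps_deriv geom = geom ^ 2"
    by (simp add: fps_inverse_deriv)
  have "fps_deriv G = of_nat (3 * d) * (1 + fps_X) ^ e * geom ^ (2 * d) +
      (1 + fps_X) ^ (3 * d) * (of_nat (2 * d) * geom ^ (2 * d + 1))"
    unfolding G_def e f
    by (simp only: fps_deriv_mult fps_deriv_power dg fps_of_nat) (simp add: algebra_simps power2_eq_square)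
  then have "fps_deriv G = of_nat d * (1 + fps_X) ^ e * geom ^ (2 * d) * (3 + 2 * (1 + fps_X) * geom)"
    by (simp only: p of_nat_mult) (simp add: algebra_simps)
  moreover have "geom ^ (2 * d) = (1 - fps_X) * geom * geom ^ (2 * d)"
    by (simp only: geom_mult mult_1)
  ultimately have "fps_X * fps_deriv G - of_nat d * G =
      - (of_nat d * kern (3 * d - 1) d)"
  proof -
    assume *: "fps_deriv G = of_nat d * (1 + fps_X) ^ e * geom ^ (2 * d) * (3 + 2 * (1 + fps_X) * geom)"
    have "fps_X * fps_deriv G - of_nat d * G = of_nat d * (1 + fps_X) ^ e * geom ^ (2 * d) *
        (fps_X * (3 + 2 * (1 + fps_X) * geom) - (1 + fps_X))"
      unfolding * unfolding G_def e by (simp add: algebra_simps)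
    \<comment> \<open>Inserting \<open>(1 - X) * geom = 1\<close> beside \<open>2 * X - 1\<close>
      brings everything over the denominator \<open>1 - X\<close>, where the quadratic terms
      cancel.\<close>
    also have "fps_X * (3 + 2 * (1 + fps_X) * geom) - (1 + fps_X) =
        (1 - fps_X) * geom * (2 * fps_X - 1) + 2 * fps_X * (1 + fps_X) * geom"
      by (simp only: geom_mult) (simp add: algebra_simps)
    also have "\<dots> = - ((1 - 5 * fps_X) * geom)"
      by (simp add: algebra_simps)
    finally show ?thesis using e by (simp add: kern_def algebra_simps)
  qed
  then have "fps_nth (fps_X * fps_deriv G - of_nat d * G) d = - (of_nat d * fps_nth (kern (3 * d - 1) d) d)"
    by (simp add: fps_of_nat[symmetric])
  moreover have "fps_nth (fps_X * fps_deriv G - of_nat d * G) d = 0"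
    using assms by (simp add: fps_of_nat[symmetric])
  ultimately show ?thesis using assms by simp
qed

text \<open>Half the Euclidean weight of a word in an even code, and the order in \<open>X\<close>
  of its term on the conic.\<close>

definition weight :: "nat \<Rightarrow> (nat \<Rightarrow> kleinian) \<Rightarrow> nat" where
  "weight n x = num1 n x div 2 + num2 n x"

text \<open>On the curve \<open>B = c * (2 - c)\<close>, where \<open>1 - B + 4 * c = (1 + c)\<^sup>2\<close>, the second
  invariant is determined by the first.\<close>

lemma curve_enum:
  assumes "L_code n C" "even_code n C" "self_dual n C" and K: "n < 3 * K"
  shows "fps_nth ((\<Sum>x\<in>C. fps_X ^ weight n x * (2 - fps_X) ^ (num1 n x div 2)) * kern (3 * K - n - 1) K) K = 0"
proof -
  \<comment> \<open>Substitution of the conic: \<open>c\<close> becomes \<open>X\<close> and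
    \<open>B\<close> becomes \<open>X * (2 - X)\<close>.\<close>
  define E :: "real poly poly \<Rightarrow> real fps" where "E q = fps_of_poly (poly q [:0, 2, -1:])" for q
  have X: "fps_of_poly [:a, b:] = fps_const a + fps_const b * fps_X" for a b :: real
    by (simp add: fps_of_poly_pCons mult.commute)
  have E_mult: "E (p * q) = E p * E q" for p q by (simp add: E_def fps_of_poly_mult)
  have E_add: "E (p + q) = E p + E q" for p q by (simp add: E_def fps_of_poly_add)
  have E_power: "E (p ^ k) = E p ^ k" for p k by (simp add: E_def fps_of_poly_power)
  have "[:0, 2, -1:] = [:0, 1:] * [:2, -1::real:]" by simp
  then have E_B: "fps_of_poly [:0, 2, -1::real:] = fps_X * (2 - fps_X)"
    by (simp only: fps_of_poly_mult X) (simp add: algebra_simps fps_numeral_fps_const)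
  have "fps_nth (E (enum_poly n C) * kern (3 * K - n - 1) K) K = 0"
  proof (induction rule: enum_poly_induct[OF assms(1-3)])
    case (1 r i j k)
    \<comment> \<open>The \<open>k\<close> factors \<open>X * (1 - X)^2\<close> lower the kernel
      from \<open>K\<close> to \<open>d\<close>. From \<open>3 * k \<le> n < 3 * K\<close> follows
      \<open>d \<ge> 1\<close>, as the residue lemma demands.\<close>
    define d where "d = K - k"
    have d: "d \<ge> 1" "K = d + k" "3 * K - n - 1 + (i + 2 * j) = 3 * d - 1"
      using K 1 by (auto simp: d_def)
    have "E [:[:r:]:] = fps_const r" "E [:[:1, 1:]:] = 1 + fps_X"
      by (simp_all add: E_def X)
    moreover have "E [:[:1, 4:], -1:] = (1 + fps_X)\<^sup>2"
    proof -
      have "poly [:[:1, 4:], -1:] [:0, 2, -1:] = [:1, 1::real:]\<^sup>2"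
        by (simp add: power2_eq_square one_pCons)
      then show ?thesis by (simp only: E_def fps_of_poly_power X) simp
    qed
    moreover have "E [:[:0, 1:], [:0, -1:]:] = fps_X * (1 - fps_X)\<^sup>2"
    proof -
      have "poly [:[:0, 1:], [:0, -1:]:] [:0, 2, -1:] = [:0, 1:] * [:1, -1::real:]\<^sup>2"
        by (simp add: power2_eq_square)
      then show ?thesis by (simp only: E_def fps_of_poly_power fps_of_poly_mult X) simp
    qed
    ultimately have "E ([:[:r:]:] * [:[:1, 1:]:] ^ i * [:[:1, 4:], -1:] ^ j * [:[:0, 1:], [:0, -1:]:] ^ k) =
        fps_const r * ((1 + fps_X) ^ (i + 2 * j) * fps_X ^ k * (1 - fps_X) ^ (2 * k))"
      by (simp only: E_mult E_power) (simp add: power_add power_mult_distrib mult_ac flip: power_mult)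
    also have "\<dots> * kern (3 * K - n - 1) K = fps_const r * (fps_X ^ k * kern (3 * d - 1) d)"
    proof -
      have "(1 - fps_X) ^ (2 * k) * geom ^ (2 * k) = 1"
        by (simp only: geom_mult flip: power_mult_distrib) simp
      moreover have "(1 + fps_X :: real fps) ^ (i + 2 * j) * (1 + fps_X) ^ (3 * K - n - 1) = (1 + fps_X) ^ (3 * d - 1)"
        by (metis d(3) add.commute power_add)
      moreover have g: "geom ^ (2 * K + 1) = geom ^ (2 * k) * geom ^ (2 * d + 1)"
        by (simp add: d(2) algebra_simps flip: power_add)
      have "fps_const r * ((1 + fps_X) ^ (i + 2 * j) * fps_X ^ k * (1 - fps_X) ^ (2 * k)) * kern (3 * K - n - 1) K =
          fps_const r * (fps_X ^ k * (((1 + fps_X) ^ (i + 2 * j) * (1 + fps_X) ^ (3 * K - n - 1)) * (1 - 5 * fps_X) *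
            (((1 - fps_X) ^ (2 * k) * geom ^ (2 * k)) * geom ^ (2 * d + 1))))"
        unfolding kern_def g by (simp only: mult_ac)
      ultimately show ?thesis
        by (simp only: kern_def mult_1)
    qed
    finally show ?case
      by (simp only: fps_mult_left_const_nth fps_X_power_mult_nth flip: d_def)
        (simp only: kern_residue[OF d(1)] if_cancel mult_zero_right)
  next
    case (2 p q)
    then show ?case by (simp add: E_add distrib_right)
  qed
  moreover have "E (enum_poly n C) = (\<Sum>x\<in>C. fps_X ^ weight n x * (2 - fps_X) ^ (num1 n x div 2))"
    by (simp add: E_def enum_poly_def poly_sum poly_monom fps_of_poly_sum fps_of_poly_mult
        fps_of_poly_power fps_of_poly_monom E_B weight_def power_add power_mult_distrib mult_ac)
  ultimately show ?thesis by simp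
qed

lemma kern_nth_0: "fps_nth (kern e K) 0 = 1"
  by (simp add: kern_def fps_power_zeroth)

lemma fps_power_nth_1:
  fixes f :: "real fps"
  assumes "fps_nth f 0 = 1"
  shows "fps_nth (f ^ k) 1 = of_nat k * fps_nth f 1"
  using assms by (induction k) (simp_all add: fps_mult_nth_1' fps_power_zeroth algebra_simps)

lemma kern_nth_1: "fps_nth (kern e K) 1 = real e + 2 * real K - 4"
proof -
  have "fps_nth geom 1 = 1" by (simp add: fps_inverse_one_minus_fps_X)
  then have "fps_nth (geom ^ (2 * K + 1)) 1 = 2 * real K + 1"
    by (subst fps_power_nth_1) simp_all
  moreover have "fps_nth ((1 + fps_X :: real fps) ^ e) 1 = real e"
    by (subst fps_power_nth_1) simp_all
  ultimately show ?thesis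
    by (simp add: kern_def fps_mult_nth_1' fps_power_zeroth)
qed

lemma two_minus_X_power:
  "fps_nth ((2 - fps_X :: real fps) ^ r) 0 = 2 ^ r"
  "fps_nth ((2 - fps_X :: real fps) ^ r) 1 = - (real r / 2) * 2 ^ r"
proof -
  show 0: "fps_nth ((2 - fps_X :: real fps) ^ r) 0 = 2 ^ r" for r
    by (simp add: fps_power_zeroth)
  show "fps_nth ((2 - fps_X :: real fps) ^ r) 1 = - (real r / 2) * 2 ^ r"
    by (induction r) (simp_all add: fps_mult_nth_1' 0 fps_numeral_nth field_simps)
qed

text \<open>
  The coefficients at \<open>K = m + 1\<close> and \<open>K = m + 2\<close> in \<open>curve_enum\<close> involve, besides the zero word, only
  the words of minimal weight \<open>m + 1\<close> and, with a positive factor, those of weight \<open>m + 2\<close>. A word of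
  weight \<open>w\<close> has at most \<open>w\<close> pairs of letters \<open>1\<close>, which bounds \<open>D\<close> by \<open>(m + 1) * A\<close>.
\<close>

lemma leading_kern_inequality:
  assumes C: "L_code n C" "even_code n C" "self_dual n C"
    and n: "n = 3 * m + \<rho>" "\<rho> \<le> 2"
    and wt: "\<And>x. x \<in> C \<Longrightarrow> x \<noteq> \<one>\<^bsub>words n\<^esub> \<Longrightarrow> m + 1 \<le> weight n x"
  shows "(3 * real (m + 1) / 2 + 3 - real \<rho>) * fps_nth (kern (2 - \<rho>) (m + 1)) (m + 1)
    \<ge> fps_nth (kern (5 - \<rho>) (m + 2)) (m + 2)"
proof -
  let ?o = "\<one>\<^bsub>words n\<^esub>"
  have one: "?o \<in> C"
    using C(1) by (simp add: L_code_def subgroup.one_closed)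
  have fin: "finite C"
    using C(1) finite_words by (metis L_code_def finite_subset subgroup.subset)
  have "num1 n ?o = 0" "num2 n ?o = 0"
    by (auto simp: num1_def num2_def one_words zero_prod_def)
  then have o: "weight n ?o = 0" "num1 n ?o div 2 = 0"
    by (simp_all add: weight_def)
  define r where "r x = num1 n x div 2" for x
  define N where "N j = {x \<in> C - {?o}. weight n x = j}" for j
  define t where "t K x = fps_nth (fps_X ^ weight n x * (2 - fps_X) ^ r x * kern (3 * K - n - 1) K) K" for K x
  have finN: "finite (N j)" for j using fin by (simp add: N_def)
  have tK: "t K x = (if K < weight n x then 0 else fps_nth ((2 - fps_X) ^ r x * kern (3 * K - n - 1) K) (K - weight n x))" for K x
    by (simp only: t_def mult.assoc fps_X_power_mult_nth)
  have sum: "fps_nth (kern (3 * K - n - 1) K) K + (\<Sum>x\<in>C - {?o}. t K x) = 0" if "n < 3 * K" for K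
  proof -
    have "(\<Sum>x\<in>C. t K x) = 0"
      using curve_enum[OF C that] by (simp add: t_def r_def sum_distrib_right fps_sum_nth)
    moreover have "t K ?o = fps_nth (kern (3 * K - n - 1) K) K"
      by (simp add: tK o r_def)
    ultimately show ?thesis
      using one fin by (simp add: sum.remove)
  qed
  have e: "3 * (m + 1) - n - 1 = 2 - \<rho>" "3 * (m + 2) - n - 1 = 5 - \<rho>"
    using n by auto
  \<comment> \<open>The factors \<open>2 ^ r\<close> and \<open>r * 2 ^ r\<close> come from the two
    lowest coefficients of \<open>(2 - X) ^ r\<close>.\<close>
  define A where "A = (\<Sum>x\<in>N (m + 1). 2 ^ r x :: real)"
  define D where "D = (\<Sum>x\<in>N (m + 1). real (r x) * 2 ^ r x)"
  define B where "B = (\<Sum>x\<in>N (m + 2). 2 ^ r x :: real)"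
  \<comment> \<open>A word of weight \<open>w\<close> contributes a multiple of
    \<open>X ^ w\<close>, so coefficient \<open>K\<close> only sees words with
    \<open>w \<le> K\<close>.\<close>
  have z1: "t (m + 1) x = 0" if "x \<in> C - {?o} - N (m + 1)" for x
    using that wt[of x] by (auto simp: N_def tK)
  have z2: "t (m + 2) x = 0" if "x \<in> C - {?o} - (N (m + 1) \<union> N (m + 2))" for x
    using that wt[of x] by (auto simp: N_def tK)
  have "(\<Sum>x\<in>C - {?o}. t (m + 1) x) = (\<Sum>x\<in>N (m + 1). t (m + 1) x)"
    by (rule sum.mono_neutral_right) (use fin z1 in \<open>auto simp: N_def\<close>)
  also have "\<dots> = A"
    unfolding A_def by (intro sum.cong) (auto simp: N_def tK kern_nth_0 two_minus_X_power)
  finally have 1: "fps_nth (kern (2 - \<rho>) (m + 1)) (m + 1) + A = 0"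
    using sum[of "m + 1"] n unfolding e by simp
  have "(\<Sum>x\<in>C - {?o}. t (m + 2) x) = (\<Sum>x\<in>N (m + 1) \<union> N (m + 2). t (m + 2) x)"
    by (rule sum.mono_neutral_right) (use fin z2 in \<open>auto simp: N_def\<close>)
  also have "\<dots> = (\<Sum>x\<in>N (m + 1). t (m + 2) x) + (\<Sum>x\<in>N (m + 2). t (m + 2) x)"
    by (rule sum.union_disjoint) (simp_all add: finN, auto simp: N_def)
  also have "(\<Sum>x\<in>N (m + 2). t (m + 2) x) = B"
    unfolding B_def by (intro sum.cong) (auto simp: N_def tK kern_nth_0 two_minus_X_power)
  \<comment> \<open>The linear coefficient \<open>e + 2 * K - 4\<close> of the kernel, at
    \<open>e = 5 - \<rho>\<close> and \<open>K = m + 2\<close>, is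
    \<open>2 * m + 5 - \<rho>\<close>.\<close>
  also have "(\<Sum>x\<in>N (m + 1). t (m + 2) x) = (2 * real m + 5 - real \<rho>) * A - D / 2"
  proof -
    have "t (m + 2) x = (2 * real m + 5 - real \<rho>) * 2 ^ r x - (real (r x) * 2 ^ r x) / 2" if "x \<in> N (m + 1)" for x
    proof -
      have "t (m + 2) x = fps_nth ((2 - fps_X) ^ r x * kern (5 - \<rho>) (m + 2)) 1"
      proof -
        have "weight n x = m + 1" using that by (simp add: N_def)
        then show ?thesis unfolding tK e by (simp flip: One_nat_def)
      qed
      then show ?thesis
        using n(2) by (simp add: fps_mult_nth_1' kern_nth_0 kern_nth_1[unfolded One_nat_def]
            two_minus_X_power[unfolded One_nat_def] algebra_simps of_nat_diff)
    qed
    then show ?thesis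
      by (simp add: A_def D_def sum_subtractf sum_distrib_left sum_divide_distrib)
  qed
  finally have 2: "fps_nth (kern (5 - \<rho>) (m + 2)) (m + 2) + ((2 * real m + 5 - real \<rho>) * A - D / 2 + B) = 0"
    using sum[of "m + 2"] n unfolding e by simp
  have "B \<ge> 0" unfolding B_def by (intro sum_nonneg) simp
  moreover have "D \<le> real (m + 1) * A"
    unfolding D_def A_def sum_distrib_left
    by (intro sum_mono mult_right_mono) (auto simp: N_def r_def weight_def)
  \<comment> \<open>The factor in the claim is
    \<open>(2 * m + 5 - \<rho>) - (m + 1) / 2\<close>.\<close>
  moreover have "fps_nth (kern (2 - \<rho>) (m + 1)) (m + 1) = - A" using 1 by simp
  ultimately show ?thesis using 2 by (simp add: algebra_simps add_divide_distrib)
qed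

section \<open>Diagonal coefficients of the kernels\<close>

text \<open>Cancelling one factor \<open>geom\<close> by \<open>1 - X\<close> turns the induction
  step into Pascal's rule.\<close>

lemma geom_power_nth: "fps_nth (geom ^ Suc q) j = real ((q + j) choose q)"
proof (induction q arbitrary: j)
  case 0
  then show ?case by (simp add: fps_inverse_one_minus_fps_X)
next
  case (Suc q)
  have "geom ^ Suc q = (1 - fps_X) * geom * geom ^ Suc q"
    by (simp only: geom_mult mult_1)
  then have *: "geom ^ Suc q = geom ^ Suc (Suc q) - fps_X * geom ^ Suc (Suc q)"
    by (simp add: algebra_simps)
  show ?case
  proof (induction j)
    case 0
    then show ?case by (simp add: fps_power_zeroth del: power_Suc)
  next
    case (Suc j)
    have "fps_nth (geom ^ Suc q) (Suc j) = fps_nth (geom ^ Suc (Suc q)) (Suc j) - fps_nth (geom ^ Suc (Suc q)) j"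
      by (subst *) (simp del: power_Suc)
    then show ?case
      by (simp add: Suc \<open>\<And>j. fps_nth (geom ^ Suc q) j = _\<close> del: power_Suc)
  qed
qed

lemma binomial_descend: "real (N - k) * real (N choose k) = real N * real ((N - 1) choose k)"
  by (metis binomial_absorb_comp of_nat_mult)

text \<open>The denominator of \<open>g\<close> collects what the recurrences divide by:
  \<open>3 * k\<close>, \<open>3 * k - 1\<close>, \<open>3 * k - 2\<close> in lowering the upper
  index from \<open>3 * K\<close> to \<open>3 * K - 3\<close>, and \<open>2 * k + 1\<close>,
  \<open>2 * k + 2\<close> in raising the lower index by two.\<close>

context
  fixes K :: nat and k g :: real
  assumes K: "K \<ge> 6" and k: "k = real K"
    and g: "g = real ((3 * K) choose (2 * K)) / (3 * k * (3 * k - 1) * (3 * k - 2) * (2 * k + 2) * (2 * k + 1))"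
begin

lemma g_pos: "g > 0"
  using K by (auto simp: g k intro!: divide_pos_pos mult_pos_pos)

lemma lower_binomials:
  "real ((3 * K) choose (2 * K)) = g * (3 * k * (3 * k - 1) * (3 * k - 2) * (2 * k + 2) * (2 * k + 1))"
  "real ((3 * K - 1) choose (2 * K)) = g * (k * (3 * k - 1) * (3 * k - 2) * (2 * k + 2) * (2 * k + 1))"
  "real ((3 * K - 2) choose (2 * K)) = g * (k * (k - 1) * (3 * k - 2) * (2 * k + 2) * (2 * k + 1))"
  "real ((3 * K - 3) choose (2 * K)) = g * (k * (k - 1) * (k - 2) * (2 * k + 2) * (2 * k + 1))"
proof -
  have k6: "k \<ge> 6" using K by (simp add: k)
  have d: "(k - real i) * real ((3 * K - i) choose (2 * K)) = (3 * k - real i) * real ((3 * K - Suc i) choose (2 * K))"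
    if "i < 3" for i
    using binomial_descend[of "3 * K - i" "2 * K"] K that by (simp add: k of_nat_diff)
  show 0: "real ((3 * K) choose (2 * K)) = g * (3 * k * (3 * k - 1) * (3 * k - 2) * (2 * k + 2) * (2 * k + 1))"
    using k6 by (simp add: g)
  show 1: "real ((3 * K - 1) choose (2 * K)) = g * (k * (3 * k - 1) * (3 * k - 2) * (2 * k + 2) * (2 * k + 1))"
    using d[of 0] k6 0 by simp
  have cancel: "x = y" if "z * x = z * y" "z \<noteq> 0" for x y z :: real
    using that by simp
  have d1: "(3 * k - 1) * real ((3 * K - 2) choose (2 * K)) = (k - 1) * real ((3 * K - 1) choose (2 * K))"
    using d[of 1] by (simp add: numeral_2_eq_2)
  have d2: "(3 * k - 2) * real ((3 * K - 3) choose (2 * K)) = (k - 2) * real ((3 * K - 2) choose (2 * K))"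
    using d[of 2] by (simp add: numeral_3_eq_3)
  show 2: "real ((3 * K - 2) choose (2 * K)) = g * (k * (k - 1) * (3 * k - 2) * (2 * k + 2) * (2 * k + 1))"
    by (rule cancel[of "3 * k - 1"], unfold d1 1, simp only: mult_ac, use k6 in simp)
  show "real ((3 * K - 3) choose (2 * K)) = g * (k * (k - 1) * (k - 2) * (2 * k + 2) * (2 * k + 1))"
    by (rule cancel[of "3 * k - 2"], unfold d2 2, simp only: mult_ac, use k6 in simp)
qed

lemma upper_binomials:
  "real ((3 * K + 3) choose (2 * K + 2)) = g * (9 * k * (3 * k - 1) * (3 * k - 2) * (3 * k + 1) * (3 * k + 2))"
  "real ((3 * K + 2) choose (2 * K + 2)) = g * (3 * k * (3 * k - 1) * (3 * k - 2) * (3 * k + 1) * (3 * k + 2))"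
  "real ((3 * K + 1) choose (2 * K + 2)) = g * (3 * k * (3 * k - 1) * (3 * k - 2) * k * (3 * k + 1))"
  "real ((3 * K) choose (2 * K + 2)) = g * (3 * k * (3 * k - 1) * (3 * k - 2) * k * (k - 1))"
  "real ((3 * K - 1) choose (2 * K + 2)) = g * (k * (3 * k - 1) * (3 * k - 2) * (k - 1) * (k - 2))"
  "real ((3 * K - 2) choose (2 * K + 2)) = g * (k * (3 * k - 2) * (k - 1) * (k - 2) * (k - 3))"
  "real ((3 * K - 3) choose (2 * K + 2)) = g * (k * (k - 1) * (k - 2) * (k - 3) * (k - 4))"
proof -
  have k6: "k \<ge> 6" using K by (simp add: k)
  have cancel: "x = y" if "z * x = z * y" "z \<noteq> 0" for x y z :: real
    using that by simp
  have up: "real (Suc j) * real (N choose Suc j) = real (N - j) * real (N choose j)" for N j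
  proof (cases N)
    case (Suc n)
    have "real (Suc j) * real (Suc n choose Suc j) = real (Suc n) * real (n choose j)"
      by (metis Suc_times_binomial of_nat_mult)
    then show ?thesis
      using binomial_descend[of "Suc n" j] unfolding Suc by (simp only: diff_Suc_1)
  qed simp
  have "(2 * k + 2) * ((2 * k + 1) * real ((3 * K) choose (2 * K + 2))) =
      (k - 1) * (k * real ((3 * K) choose (2 * K)))"
  proof -
    have "(2 * k + 1) * real ((3 * K) choose (2 * K + 1)) = k * real ((3 * K) choose (2 * K))"
      using up[of "2 * K" "3 * K"] by (simp add: k add.commute)
    moreover have "(2 * k + 2) * real ((3 * K) choose (2 * K + 2)) = (k - 1) * real ((3 * K) choose (2 * K + 1))"
      using up[of "2 * K + 1" "3 * K"] K by (simp add: k of_nat_diff add.commute)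
    ultimately show ?thesis by (metis mult.left_commute)
  qed
  then have "((2 * k + 2) * (2 * k + 1)) * real ((3 * K) choose (2 * K + 2)) =
      ((2 * k + 2) * (2 * k + 1)) * (g * (3 * k * (3 * k - 1) * (3 * k - 2) * k * (k - 1)))"
    unfolding lower_binomials(1) by (simp only: mult_ac)
  then show 3: "real ((3 * K) choose (2 * K + 2)) = g * (3 * k * (3 * k - 1) * (3 * k - 2) * k * (k - 1))"
    by (rule cancel) (use k6 in auto)
  have d: "(k + 1 - real i) * real ((3 * K + 3 - i) choose (2 * K + 2)) =
      (3 * k + 3 - real i) * real ((3 * K + 3 - Suc i) choose (2 * K + 2))" if "i < 6" for i
    using binomial_descend[of "3 * K + 3 - i" "2 * K + 2"] K that by (simp add: k of_nat_diff add.commute[of "real K" 1])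
  have d2: "(k - 1) * real ((3 * K + 1) choose (2 * K + 2)) = (3 * k + 1) * real ((3 * K) choose (2 * K + 2))"
    using d[of 2] by (simp add: numeral_2_eq_2)
  have d1: "k * real ((3 * K + 2) choose (2 * K + 2)) = (3 * k + 2) * real ((3 * K + 1) choose (2 * K + 2))"
    using d[of 1] by (simp add: numeral_2_eq_2)
  have d0: "(k + 1) * real ((3 * K + 3) choose (2 * K + 2)) = (3 * k + 3) * real ((3 * K + 2) choose (2 * K + 2))"
    using d[of 0] by simp
  have d3: "(3 * k) * real ((3 * K - 1) choose (2 * K + 2)) = (k - 2) * real ((3 * K) choose (2 * K + 2))"
    using d[of 3] by simp
  have d4: "(3 * k - 1) * real ((3 * K - 2) choose (2 * K + 2)) = (k - 3) * real ((3 * K - 1) choose (2 * K + 2))"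
    using d[of 4] by simp
  have d5: "(3 * k - 2) * real ((3 * K - 3) choose (2 * K + 2)) = (k - 4) * real ((3 * K - 2) choose (2 * K + 2))"
    using d[of 5] by simp
  \<comment> \<open>Upwards from \<open>3 * K\<close> the divisors \<open>k - 1\<close> and
    \<open>k\<close> are factors of the value there, and \<open>k + 1\<close> cancels against
    \<open>3 * k + 3\<close>.\<close>
  show 2: "real ((3 * K + 1) choose (2 * K + 2)) = g * (3 * k * (3 * k - 1) * (3 * k - 2) * k * (3 * k + 1))"
    by (rule cancel[of "k - 1"], unfold d2 3, simp only: mult_ac, use k6 in simp)
  show 1: "real ((3 * K + 2) choose (2 * K + 2)) = g * (3 * k * (3 * k - 1) * (3 * k - 2) * (3 * k + 1) * (3 * k + 2))"
    by (rule cancel[of k], unfold d1 2, simp only: mult_ac, use k6 in simp)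
  show "real ((3 * K + 3) choose (2 * K + 2)) = g * (9 * k * (3 * k - 1) * (3 * k - 2) * (3 * k + 1) * (3 * k + 2))"
    by (rule cancel[of "k + 1"], unfold d0 1, simp add: algebra_simps, use k6 in simp)
  show 4: "real ((3 * K - 1) choose (2 * K + 2)) = g * (k * (3 * k - 1) * (3 * k - 2) * (k - 1) * (k - 2))"
    by (rule cancel[of "3 * k"], unfold d3 3, simp only: mult_ac, use k6 in simp)
  show 5: "real ((3 * K - 2) choose (2 * K + 2)) = g * (k * (3 * k - 2) * (k - 1) * (k - 2) * (k - 3))"
    by (rule cancel[of "3 * k - 1"], unfold d4 4, simp only: mult_ac, use k6 in simp)
  show "real ((3 * K - 3) choose (2 * K + 2)) = g * (k * (k - 1) * (k - 2) * (k - 3) * (k - 4))"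
    by (rule cancel[of "3 * k - 2"], unfold d5 5, simp only: mult_ac, use k6 in simp)
qed

end

text \<open>Convolution with the negative binomial series, whose upper index
  \<open>2 * K + (K - i)\<close> is \<open>3 * K - i\<close>.\<close>

lemma kern_diagonal:
  assumes P: "(1 + fps_X) ^ e * (1 - 5 * fps_X) = fps_of_poly p" and "degree p \<le> K"
  shows "fps_nth (kern e K) K = (\<Sum>i\<le>degree p. coeff p i * real ((3 * K - i) choose (2 * K)))"
proof -
  have "fps_nth (kern e K) K = (\<Sum>i=0..K. coeff p i * real ((2 * K + (K - i)) choose (2 * K)))"
    unfolding kern_def P by (simp add: fps_mult_nth geom_power_nth del: power_Suc flip: Suc_eq_plus1)
  also have "\<dots> = (\<Sum>i\<le>degree p. coeff p i * real ((2 * K + (K - i)) choose (2 * K)))"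
    by (rule sum.mono_neutral_right) (use assms(2) in \<open>auto simp: coeff_eq_0\<close>)
  also have "\<dots> = (\<Sum>i\<le>degree p. coeff p i * real ((3 * K - i) choose (2 * K)))"
    using assms(2) by (intro sum.cong) (auto simp: algebra_simps)
  finally show ?thesis .
qed

lemma fps_of_poly_kern: "(1 + fps_X :: real fps) ^ e * (1 - 5 * fps_X) = fps_of_poly ([:1, 1:] ^ e * [:1, -5:])"
proof -
  have "fps_of_poly [:1, 1:] = 1 + (fps_X :: real fps)" "fps_of_poly [:1, -5:] = 1 - 5 * (fps_X :: real fps)"
    by (simp_all add: fps_of_poly_pCons numeral_fps_const mult.commute)
  then show ?thesis by (simp only: fps_of_poly_mult fps_of_poly_power)
qed

text \<open>The exponents \<open>2 - \<rho>\<close> and \<open>5 - \<rho>\<close> with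
  \<open>\<rho> \<le> 2\<close> run through 0 to 5.\<close>

lemma kern_diagonals:
  fixes e K :: nat
  assumes K: "K \<ge> 6"
  defines "b \<equiv> \<lambda>i. real ((3 * K - i) choose (2 * K))"
  shows "fps_nth (kern 0 K) K = b 0 - 5 * b 1"
    "fps_nth (kern 1 K) K = b 0 - 4 * b 1 - 5 * b 2"
    "fps_nth (kern 2 K) K = b 0 - 3 * b 1 - 9 * b 2 - 5 * b 3"
    "fps_nth (kern 3 K) K = b 0 - 2 * b 1 - 12 * b 2 - 14 * b 3 - 5 * b 4"
    "fps_nth (kern 4 K) K = b 0 - b 1 - 14 * b 2 - 26 * b 3 - 19 * b 4 - 5 * b 5"
    "fps_nth (kern 5 K) K = b 0 - 15 * b 2 - 40 * b 3 - 45 * b 4 - 24 * b 5 - 5 * b 6"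
proof -
  have *: "fps_nth (kern e K) K = (\<Sum>i\<le>degree p. coeff p i * b i)"
    if "[:1, 1:] ^ e * [:1, -5:] = p" "degree p \<le> 6" for e p
    unfolding b_def using kern_diagonal[of e p K] fps_of_poly_kern[of e] that K by simp
  show "fps_nth (kern 0 K) K = b 0 - 5 * b 1"
    by (subst *[of 0 "[:1, -5:]"]) simp_all
  show "fps_nth (kern 1 K) K = b 0 - 4 * b 1 - 5 * b 2"
    by (subst *[of 1 "[:1, -4, -5:]"]) (simp_all add: eval_nat_numeral)
  show "fps_nth (kern 2 K) K = b 0 - 3 * b 1 - 9 * b 2 - 5 * b 3"
    by (subst *[of 2 "[:1, -3, -9, -5:]"]) (simp_all add: eval_nat_numeral)
  show "fps_nth (kern 3 K) K = b 0 - 2 * b 1 - 12 * b 2 - 14 * b 3 - 5 * b 4"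
    by (subst *[of 3 "[:1, -2, -12, -14, -5:]"]) (simp_all add: eval_nat_numeral)
  show "fps_nth (kern 4 K) K = b 0 - b 1 - 14 * b 2 - 26 * b 3 - 19 * b 4 - 5 * b 5"
    by (subst *[of 4 "[:1, -1, -14, -26, -19, -5:]"]) (simp_all add: eval_nat_numeral)
  show "fps_nth (kern 5 K) K = b 0 - 15 * b 2 - 40 * b 3 - 45 * b 4 - 24 * b 5 - 5 * b 6"
    by (subst *[of 5 "[:1, 0, -15, -40, -45, -24, -5:]"]) (simp_all add: eval_nat_numeral)
qed

text \<open>
  All binomial coefficients involved are polynomial multiples of the same \<open>g\<close>. Expanded at the
  smallest admissible \<open>K\<close>, the resulting polynomials have positive coefficients.
\<close>

lemma kern_inequality:
  assumes \<rho>: "\<rho> \<le> 2" and K: "K \<ge> 6 + \<rho>"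
  shows "(3 * real K / 2 + 3 - real \<rho>) * fps_nth (kern (2 - \<rho>) K) K < fps_nth (kern (5 - \<rho>) (K + 1)) (K + 1)"
proof -
  define k where "k = real K"
  define g where "g = real ((3 * K) choose (2 * K)) / (3 * k * (3 * k - 1) * (3 * k - 2) * (2 * k + 2) * (2 * k + 1))"
  have K6: "K \<ge> 6" "K + 1 \<ge> 6" using K by auto
  note low = lower_binomials[OF K6(1) k_def g_def]
  note up = upper_binomials[OF K6(1) k_def g_def]
  have g: "g > 0" by (rule g_pos[OF K6(1) k_def g_def])
  have idx: "3 * (K + 1) - 0 = 3 * K + 3" "3 * (K + 1) - 1 = 3 * K + 2" "3 * (K + 1) - 2 = 3 * K + 1"
    "3 * (K + 1) - 3 = 3 * K" "3 * (K + 1) - 4 = 3 * K - 1" "3 * (K + 1) - 5 = 3 * K - 2"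
    "3 * (K + 1) - 6 = 3 * K - 3" "2 * (K + 1) = 2 * K + 2" "3 * K - 0 = 3 * K"
    by auto
  define t where "t = k - 6 - real \<rho>"
  have t: "t \<ge> 0" "k = t + 6 + real \<rho>" using K by (simp_all add: t_def k_def)
  note d = kern_diagonals[OF K6(1), unfolded idx low] kern_diagonals[OF K6(2), unfolded idx up]
  consider "\<rho> = 0" | "\<rho> = 1" | "\<rho> = 2" using \<rho> by linarith
  then show ?thesis
  proof cases
    case 1
    \<comment> \<open>The factor 2 clears the denominator of \<open>3 * k / 2\<close>.\<close>
    have "2 * (fps_nth (kern 5 (K + 1)) (K + 1) - (3 * k / 2 + 3) * fps_nth (kern 2 K) K) =
        g * (937440 + 2427168 * t + 1805336 * t ^ 2 + 623680 * t ^ 3 + 112600 * t ^ 4 + 10352 * t ^ 5 + 384 * t ^ 6)"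
      unfolding d using t(2) 1 by (simp add: field_simps power_numeral_reduce)
    also have "\<dots> > 0" using g t(1) by (intro mult_pos_pos add_pos_nonneg) auto
    finally show ?thesis using 1 by (simp add: k_def)
  next
    case 2
    have "2 * (fps_nth (kern 4 (K + 1)) (K + 1) - (3 * k / 2 + 2) * fps_nth (kern 1 K) K) =
        g * (1021440 + 4075356 * t + 2783708 * t ^ 2 + 822348 * t ^ 3 + 124036 * t ^ 4 + 9432 * t ^ 5 + 288 * t ^ 6)"
      unfolding d using t(2) 2 by (simp add: field_simps power_numeral_reduce)
    also have "\<dots> > 0" using g t(1) by (intro mult_pos_pos add_pos_nonneg) auto
    finally show ?thesis using 2 by (simp add: k_def add.commute)
  next
    case 3
    have "2 * (fps_nth (kern 3 (K + 1)) (K + 1) - (3 * k / 2 + 1) * fps_nth (kern 0 K) K) =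
        g * (1165824 + 6431616 * t + 3906408 * t ^ 2 + 995268 * t ^ 3 + 128352 * t ^ 4 + 8316 * t ^ 5 + 216 * t ^ 6)"
      unfolding d using t(2) 3 by (simp add: field_simps power_numeral_reduce)
    also have "\<dots> > 0" using g t(1) by (intro mult_pos_pos add_pos_nonneg) auto
    finally show ?thesis using 3 by (simp add: k_def add.commute)
  qed
qed

section \<open>Graph codes\<close>

text \<open>
  The code \<open>{(x, A x)}\<close> of the adjacency matrix \<open>A\<close> of a graph, given by its neighbour lists. It is
  isotropic because \<open>A\<close> is symmetric.
\<close>

definition graph_bit :: "nat list list \<Rightarrow> nat \<Rightarrow> nat \<Rightarrow> bit" where
  "graph_bit G i j = of_bool (j \<in> set (G ! i))"

definition image_bit :: "nat list list \<Rightarrow> (nat \<Rightarrow> bit) \<Rightarrow> nat \<Rightarrow> bit" where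
  "image_bit G x i = (\<Sum>j<length G. graph_bit G i j * x j)"

definition graph_word :: "nat list list \<Rightarrow> (nat \<Rightarrow> bit) \<Rightarrow> nat \<Rightarrow> kleinian" where
  "graph_word G x = (\<lambda>i\<in>{..<length G}. (x i, image_bit G x i))"

definition graph_code :: "nat list list \<Rightarrow> (nat \<Rightarrow> kleinian) set" where
  "graph_code G = range (graph_word G)"

definition sym_graph :: "nat list list \<Rightarrow> bool" where
  "sym_graph G \<longleftrightarrow> (\<forall>i\<in>set [0..<length G]. \<forall>j\<in>set [0..<length G]. j \<in> set (G ! i) \<longleftrightarrow> i \<in> set (G ! j))"

lemma image_bit_add: "image_bit G (\<lambda>i. x i + y i) i = image_bit G x i + image_bit G y i"
  by (simp only: image_bit_def distrib_left sum.distrib)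

lemma graph_word_mult:
  "graph_word G x \<otimes>\<^bsub>words (length G)\<^esub> graph_word G y = graph_word G (\<lambda>i. x i + y i)"
proof
  fix i
  show "(graph_word G x \<otimes>\<^bsub>words (length G)\<^esub> graph_word G y) i = graph_word G (\<lambda>i. x i + y i) i"
    by (cases "i < length G")
      (simp_all only: graph_word_def mult_words image_bit_add restrict_def lessThan_iff add_Pair if_True if_False)
qed

lemma image_bit_0: "image_bit G (\<lambda>_. 0) i = 0"
  by (simp only: image_bit_def mult_zero_right sum.neutral_const)

lemma graph_word_0: "graph_word G (\<lambda>_. 0) = \<one>\<^bsub>words (length G)\<^esub>"
  by (simp add: graph_word_def one_words image_bit_0 zero_prod_def)

lemma bit_add_self: "(a::bit) + a = 0"
  by (cases a) simp_all

lemma L_code_graph_code: "L_code (length G) (graph_code G)"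
proof -
  interpret W: group "words (length G)" by (rule group_words)
  have in_carrier: "graph_word G x \<in> carrier (words (length G))" for x
    by (simp add: carrier_words graph_word_def)
  \<comment> \<open>Words have order at most 2, so each is its own inverse.\<close>
  have "graph_word G x \<otimes>\<^bsub>words (length G)\<^esub> graph_word G x = \<one>\<^bsub>words (length G)\<^esub>" for x
    by (simp only: graph_word_mult bit_add_self graph_word_0)
  then have "inv\<^bsub>words (length G)\<^esub> graph_word G x = graph_word G x" for x
    using in_carrier by (intro W.inv_equality)
  then show ?thesis
    unfolding L_code_def graph_code_def
    by (intro W.subgroupI) (auto simp: in_carrier graph_word_mult)
qed

lemma scalar_product_graph_word:
  "scalar_product (length G) y (graph_word G x) =
   (\<Sum>i<length G. fst (y i) * image_bit G x i) + (\<Sum>i<length G. snd (y i) * x i)"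
proof -
  have "dot (y i) (graph_word G x i) = fst (y i) * image_bit G x i + snd (y i) * x i" if "i < length G" for i
    using that by (cases "y i") (simp only: graph_word_def restrict_apply' lessThan_iff dot_simps fst_conv snd_conv)
  then have "scalar_product (length G) y (graph_word G x) =
      (\<Sum>i<length G. fst (y i) * image_bit G x i + snd (y i) * x i)"
    unfolding scalar_product_def by (intro sum.cong) auto
  then show ?thesis by (simp only: sum.distrib)
qed

lemma image_bit_adjoint:
  assumes "sym_graph G"
  shows "(\<Sum>i<length G. y i * image_bit G x i) = (\<Sum>i<length G. image_bit G y i * x i)"
proof -
  have s: "graph_bit G i j = graph_bit G j i" if "i < length G" "j < length G" for i j
    using assms that by (simp add: sym_graph_def graph_bit_def)
  have "(\<Sum>i<length G. y i * image_bit G x i) = (\<Sum>i<length G. \<Sum>j<length G. y i * (graph_bit G i j * x j))"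
    by (simp only: image_bit_def sum_distrib_left)
  also have "\<dots> = (\<Sum>j<length G. \<Sum>i<length G. y i * (graph_bit G i j * x j))"
    by (rule sum.swap)
  also have "\<dots> = (\<Sum>j<length G. \<Sum>i<length G. graph_bit G j i * y i * x j)"
    by (intro sum.cong refl) (use s in \<open>simp only: lessThan_iff mult_ac\<close>)
  also have "\<dots> = (\<Sum>j<length G. image_bit G y j * x j)"
    by (simp only: image_bit_def sum_distrib_right)
  finally show ?thesis .
qed

definition unit_bit :: "nat \<Rightarrow> nat \<Rightarrow> bit" where
  "unit_bit j i = of_bool (i = j)"

lemma sum_unit_bit: "j < n \<Longrightarrow> (\<Sum>i<n. f i * unit_bit j i) = f j"
proof -
  assume j: "j < n"
  have "f i * unit_bit j i = (if i = j then f i else 0)" for i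
    by (cases "i = j") (simp_all add: unit_bit_def)
  then have "(\<Sum>i<n. f i * unit_bit j i) = (\<Sum>i<n. if i = j then f i else 0)"
    by (intro sum.cong) auto
  then show ?thesis using j by (simp only: sum.delta finite_lessThan lessThan_iff if_True)
qed

text \<open>Since \<open>A\<close> is self-adjoint, the two halves of each product of codewords
  coincide and cancel in characteristic 2. Conversely, orthogonality to the words of the
  \<open>unit_bit j\<close> forces the second components of a word to be the image of the
  first.\<close>

lemma self_dual_graph_code:
  assumes G: "sym_graph G"
  shows "self_dual (length G) (graph_code G)"
  unfolding self_dual_def
proof (intro equalityI subsetI)
  fix w assume "w \<in> graph_code G"
  then obtain x where w: "w = graph_word G x" by (auto simp: graph_code_def)
  have "scalar_product (length G) w (graph_word G y) = 0" for y
  proof -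
    have "(\<Sum>i<length G. fst (w i) * image_bit G y i) = (\<Sum>i<length G. x i * image_bit G y i)"
      "(\<Sum>i<length G. snd (w i) * y i) = (\<Sum>i<length G. image_bit G x i * y i)"
      unfolding w graph_word_def by (intro sum.cong; simp)+
    then show ?thesis
      by (simp only: scalar_product_graph_word image_bit_adjoint[OF G] bit_add_self)
  qed
  then show "w \<in> dual (length G) (graph_code G)"
    by (simp add: dual_def graph_code_def w carrier_words) (simp add: graph_word_def)
next
  fix w assume "w \<in> dual (length G) (graph_code G)"
  then have w: "w \<in> carrier (words (length G))"
    and orth: "\<And>x. scalar_product (length G) w (graph_word G x) = 0"
    by (auto simp: dual_def graph_code_def)
  let ?u = "\<lambda>i. fst (w i)"
  have "w j = (?u j, image_bit G ?u j)" if j: "j < length G" for j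
  proof -
    have "image_bit G ?u j + snd (w j) = 0"
      using orth[of "unit_bit j"]
      by (simp only: scalar_product_graph_word image_bit_adjoint[OF G] sum_unit_bit[OF j])
    then have "snd (w j) = image_bit G ?u j"
      by (metis add_left_cancel bit_add_self)
    then show ?thesis by (metis prod.collapse)
  qed
  then have "w = graph_word G ?u"
    using w by (intro ext) (auto simp: graph_word_def carrier_words dest: PiE_arb)
  then show "w \<in> graph_code G" by (auto simp: graph_code_def)
qed

section \<open>Checking a graph code by enumeration\<close>

definition pair_wt :: "bool \<times> bool \<Rightarrow> nat" where
  "pair_wt p = (case p of (a, b) \<Rightarrow> if a then if b then 1 else 2 else if b then 2 else 0)"

definition list_wt :: "(bool \<times> bool) list \<Rightarrow> nat" where
  "list_wt ps = fold (\<lambda>p n. pair_wt p + n) ps 0"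

fun list_xor :: "(bool \<times> bool) list \<Rightarrow> (bool \<times> bool) list \<Rightarrow> (bool \<times> bool) list" where
  "list_xor ((a, b) # ps) ((c, d) # qs) = (a \<noteq> c, b \<noteq> d) # list_xor ps qs"
| "list_xor _ _ = []"

text \<open>A binary tree over all sums of subsets of the generators, with \<open>ps\<close> the
  partial sum reached. The case \<open>w = 0\<close> admits the zero word.\<close>

fun check_span :: "nat \<Rightarrow> (bool \<times> bool) list list \<Rightarrow> (bool \<times> bool) list \<Rightarrow> bool" where
  "check_span d [] ps = (let w = list_wt ps in even w \<and> (w = 0 \<or> d \<le> w))"
| "check_span d (q # qs) ps = (check_span d qs ps \<and> check_span d qs (list_xor ps q))"

definition graph_row :: "nat list list \<Rightarrow> nat \<Rightarrow> (bool \<times> bool) list" where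
  "graph_row G j = map (\<lambda>i. (i = j, j \<in> set (G ! i))) [0..<length G]"

text \<open>The list \<open>xs\<close> is the support of an \<open>x\<close> for which the weight \<open>d\<close> is attained.\<close>

definition check_graph :: "nat \<Rightarrow> nat list list \<Rightarrow> nat list \<Rightarrow> bool" where
  "check_graph d G xs \<longleftrightarrow> sym_graph G \<and> list_all (\<lambda>j. j < length G) xs \<and>
     check_span d (map (graph_row G) [0..<length G]) (replicate (length G) (False, False)) \<and>
     list_wt (foldr (\<lambda>j. list_xor (graph_row G j)) xs (replicate (length G) (False, False))) = d"

definition word_list :: "nat list list \<Rightarrow> (nat \<Rightarrow> bit) \<Rightarrow> (bool \<times> bool) list" where
  "word_list G x = map (\<lambda>i. (x i = 1, image_bit G x i = 1)) [0..<length G]"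

lemma norm2_eq_pair_wt: "norm2 (a, b) = pair_wt (a = 1, b = 1)"
  by (cases a; cases b) (simp_all add: norm2_def pair_wt_def zero_prod_def)

lemma list_wt_eq: "list_wt ps = sum_list (map pair_wt ps)"
proof -
  have "fold (\<lambda>p n. pair_wt p + n) ps k = sum_list (map pair_wt ps) + k" for k
    by (induction ps arbitrary: k) simp_all
  then show ?thesis by (simp add: list_wt_def)
qed

lemma ewt_graph_word: "ewt (length G) (graph_word G x) = list_wt (word_list G x)"
proof -
  have "ewt (length G) (graph_word G x) = (\<Sum>i<length G. pair_wt (x i = 1, image_bit G x i = 1))"
    unfolding ewt_def by (intro sum.cong) (simp_all add: graph_word_def norm2_eq_pair_wt)
  also have "\<dots> = sum_list (map (\<lambda>i. pair_wt (x i = 1, image_bit G x i = 1)) [0..<length G])"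
    by (simp add: interv_sum_list_conv_sum_set_nat atLeast0LessThan)
  finally show ?thesis by (simp add: list_wt_eq word_list_def o_def)
qed

lemma list_xor_map:
  "list_xor (map (\<lambda>i. (f i, g i)) is) (map (\<lambda>i. (h i, k i)) is) = map (\<lambda>i. (f i \<noteq> h i, g i \<noteq> k i)) is"
  by (induction "is") simp_all

lemma bit_add_eq_1_iff: "(a::bit) + b = 1 \<longleftrightarrow> (a = 1) \<noteq> (b = 1)"
  by (cases a; cases b) simp_all

lemma word_list_add: "list_xor (word_list G x) (word_list G y) = word_list G (\<lambda>i. x i + y i)"
  by (simp only: word_list_def list_xor_map image_bit_add bit_add_eq_1_iff)

lemma word_list_unit:
  assumes "j < length G"
  shows "word_list G (unit_bit j) = graph_row G j"
proof -
  have "image_bit G (unit_bit j) i = graph_bit G i j" for i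
    by (simp only: image_bit_def sum_unit_bit[OF assms])
  then show ?thesis by (simp add: word_list_def graph_row_def graph_bit_def unit_bit_def)
qed

lemma word_list_0: "word_list G (\<lambda>_. 0) = replicate (length G) (False, False)"
  by (simp add: word_list_def image_bit_0 map_replicate_const)

text \<open>\<open>x\<close> is the choice made so far and \<open>y\<close> the part still open,
  supported on the remaining generators.\<close>

lemma check_span_sound:
  assumes "check_span d (map (graph_row G) js) (word_list G x)" "set js \<subseteq> {..<length G}"
    and "\<And>i. y i \<noteq> 0 \<Longrightarrow> i \<in> set js"
  shows "let w = list_wt (word_list G (\<lambda>i. x i + y i)) in even w \<and> (w = 0 \<or> d \<le> w)"
  using assms
proof (induction js arbitrary: x y)
  case Nil
  then have "y i = 0" for i by (metis empty_iff list.set(1))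
  then have "(\<lambda>i. x i + y i) = x" by (simp only: add_0_right)
  then show ?case using Nil.prems(1) by simp
next
  case (Cons j js)
  show ?case
  proof (cases "y j = 0")
    case True
    then have "i \<in> set js" if "y i \<noteq> 0" for i
      using Cons.prems(3)[OF that] that by auto
    then show ?thesis using Cons.IH[of x y] Cons.prems by simp
  next
    case False
    \<comment> \<open>Adding the basis vector clears component \<open>j\<close> of \<open>y\<close>,
      which moves over to \<open>x\<close>.\<close>
    define z where "z i = unit_bit j i + y i" for i
    have "i \<in> set js" if "z i \<noteq> 0" for i
      using Cons.prems(3)[of i] that False by (cases "i = j") (auto simp: z_def unit_bit_def)
    moreover have "word_list G (\<lambda>i. x i + unit_bit j i) = list_xor (word_list G x) (graph_row G j)"
      using Cons.prems(2) by (simp only: word_list_unit flip: word_list_add) (simp add: word_list_unit)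
    then have "check_span d (map (graph_row G) js) (word_list G (\<lambda>i. x i + unit_bit j i))"
      using Cons.prems(1) by (simp only: check_span.simps list.map)
    ultimately have "let w = list_wt (word_list G (\<lambda>i. x i + unit_bit j i + z i)) in even w \<and> (w = 0 \<or> d \<le> w)"
      using Cons.prems(2) by (intro Cons.IH) simp_all
    moreover have "x i + unit_bit j i + z i = x i + y i" for i
      unfolding z_def by (metis add.assoc add.left_neutral add.commute bit_add_self)
    ultimately show ?thesis by (simp only:)
  qed
qed

lemma image_bit_cong:
  "(\<And>i. i < length G \<Longrightarrow> x i = y i) \<Longrightarrow> image_bit G x i = image_bit G y i"
  unfolding image_bit_def by (intro sum.cong) simp_all

theorem extremal_graph_code:
  assumes G: "length G \<ge> 1" and check: "check_graph (2 * (length G div 3) + 2) G xs"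
  shows "extremal_even_self_dual (length G) (graph_code G)"
proof -
  let ?n = "length G" and ?d = "2 * (length G div 3) + 2"
  have sym: "sym_graph G" and xs: "list_all (\<lambda>j. j < ?n) xs"
    and span: "check_span ?d (map (graph_row G) [0..<?n]) (word_list G (\<lambda>_. 0))"
    and att: "list_wt (foldr (\<lambda>j. list_xor (graph_row G j)) xs (word_list G (\<lambda>_. 0))) = ?d"
    using check by (simp_all add: check_graph_def word_list_0)
  have good: "even (ewt ?n w) \<and> (ewt ?n w = 0 \<or> ?d \<le> ewt ?n w)" if "w \<in> graph_code G" for w
  proof -
    obtain x where w: "w = graph_word G x"
      using \<open>w \<in> graph_code G\<close> by (auto simp: graph_code_def)
    \<comment> \<open>\<open>x\<close> is arbitrary beyond the length of the code; cutting it off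
      gives a support among the generators without changing the word.\<close>
    define y where "y i = (if i < ?n then x i else 0)" for i
    have "word_list G x = word_list G y"
      unfolding word_list_def using image_bit_cong[of G x y] by (auto simp: y_def)
    moreover have "let v = list_wt (word_list G (\<lambda>i. 0 + y i)) in even v \<and> (v = 0 \<or> ?d \<le> v)"
      by (rule check_span_sound[OF span]) (auto simp: y_def split: if_splits)
    ultimately show ?thesis
      by (simp only: w ewt_graph_word Let_def add_0_left)
  qed
  \<comment> \<open>The list \<open>xs\<close> yields a codeword of weight \<open>?d\<close>, so the
    lower bound is attained.\<close>
  have "\<exists>x. word_list G x = foldr (\<lambda>j. list_xor (graph_row G j)) xs (word_list G (\<lambda>_. 0))"
    using xs
  proof (induction xs)
    case (Cons j xs)
    then show ?case by (auto simp: word_list_add simp flip: word_list_unit) (metis word_list_add)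
  qed auto
  then obtain x where "list_wt (word_list G x) = ?d" using att by metis
  then have x: "ewt ?n (graph_word G x) = ?d" by (simp add: ewt_graph_word)
  have sd: "self_dual ?n (graph_code G)" using sym by (rule self_dual_graph_code)
  have L: "L_code ?n (graph_code G)" by (rule L_code_graph_code)
  have fin: "finite (graph_code G)" by (rule self_dual_nonzero(1)[OF G sd])
  have zero: "ewt ?n w = 0 \<longleftrightarrow> w = \<one>\<^bsub>words ?n\<^esub>" if "w \<in> graph_code G" for w
  proof
    assume "ewt ?n w = 0"
    then have "\<forall>i<?n. norm2 (w i) = 0" by (simp add: ewt_def)
    then have "\<forall>i<?n. w i = 0" by (metis norm2_def zero_neq_numeral zero_neq_one)
    moreover have "w \<in> carrier (words ?n)"
      using that L by (metis L_code_def subgroup.mem_carrier)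
    ultimately show "w = \<one>\<^bsub>words ?n\<^esub>" by (intro eq_one_words) auto
  qed (simp add: ewt_def one_words norm2_def)
  have "min_ewt ?n (graph_code G) = ?d"
    unfolding min_ewt_def
  proof (rule Min_eqI)
    have "graph_word G x \<in> graph_code G" by (simp add: graph_code_def)
    then show "?d \<in> ewt ?n ` (graph_code G - {\<one>\<^bsub>words ?n\<^esub>})"
      using x zero by (metis (no_types, lifting) Diff_iff add_is_0 image_eqI singletonD zero_neq_numeral)
  qed (use fin good zero in auto)
  then show ?thesis
    using L sd good by (simp add: extremal_even_self_dual_def even_code_def)
qed

section \<open>Extremal codes\<close>

text \<open>Row \<open>r\<close> is tested from column \<open>j - r\<close> on; truncated
  subtraction tests whole rows once \<open>r \<ge> j\<close>.\<close>

fun nonneg_from :: "nat \<Rightarrow> int list list \<Rightarrow> bool" where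
  "nonneg_from j [] = True"
| "nonneg_from j (xs # T) = (list_all (\<lambda>a. 0 \<le> a) (drop j xs) \<and> nonneg_from (j - 1) T)"

text \<open>
  Entries \<open>(r, s)\<close> with \<open>0 < r + s \<le> n div 3\<close> are not restricted, as an extremal code has no words
  there. The tables below are Farkas certificates of the linear program for the numbers of words
  with \<open>2 * r\<close> letters \<open>1\<close> and \<open>s\<close> letters \<open>\<omega>\<close> or \<open>\<omega>\<close>-bar, with denominators cleared.
\<close>

definition certificate :: "nat \<Rightarrow> int list list \<Rightarrow> bool" where
  "certificate n T \<longleftrightarrow> 0 < hd (hd T) \<and> T \<noteq> [] \<and> hd T \<noteq> [] \<and> nonneg_from (n div 3 + 1) T \<and> vanish3 n T"

lemma nonneg_from_entry:
  "nonneg_from j T \<Longrightarrow> j \<le> r + s \<Longrightarrow> 0 \<le> entry T r s"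
proof (induction T arbitrary: j r)
  case Nil
  then show ?case by (simp add: entry_def)
next
  case (Cons xs T)
  show ?case
  proof (cases r)
    case 0
    have "0 \<le> xs ! s" if "s < length xs"
    proof -
      have "xs ! s = drop j xs ! (s - j)" "s - j < length (drop j xs)"
        using Cons.prems(2) 0 that by auto
      then show ?thesis using Cons.prems(1) by (auto simp: list_all_length)
    qed
    then show ?thesis using 0 by (simp add: entry_def nth_default_def)
  next
    case (Suc r')
    then show ?thesis using Cons.IH[of "j - 1" r'] Cons.prems by (simp add: entry_def)
  qed
qed

lemma extremal_weight:
  assumes "n \<ge> 1" "extremal_even_self_dual n C" "x \<in> C" "x \<noteq> \<one>\<^bsub>words n\<^esub>"
  shows "n div 3 + 1 \<le> weight n x"
proof -
  have sd: "self_dual n C" and ev: "even_code n C" and min: "min_ewt n C = 2 * (n div 3) + 2"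
    using assms(2) by (auto simp: extremal_even_self_dual_def)
  have "min_ewt n C \<le> ewt n x"
    unfolding min_ewt_def using self_dual_nonzero(1)[OF assms(1) sd] assms(3,4) by (intro Min_le) auto
  moreover have "ewt n x = 2 * weight n x"
    using even_num1[OF ev assms(3)] by (auto simp: ewt_num weight_def)
  ultimately show ?thesis using min by simp
qed

text \<open>The relation sums to 0, yet the zero word contributes a positive entry and all other
  words nonnegative ones.\<close>

theorem certificate_excludes:
  assumes "n \<ge> 1" and T: "certificate n T"
  shows "\<not> extremal_even_self_dual n C"
proof
  assume C: "extremal_even_self_dual n C"
  then have C': "L_code n C" "even_code n C" "self_dual n C"
    by (auto simp: extremal_even_self_dual_def)
  let ?o = "\<one>\<^bsub>words n\<^esub>" and ?f = "\<lambda>x. entry T (num1 n x div 2) (num2 n x)"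
  have "?o \<in> C" using C'(1) by (simp add: L_code_def subgroup.one_closed)
  moreover have "finite C" by (rule self_dual_nonzero(1)[OF assms(1) C'(3)])
  ultimately have "(\<Sum>x\<in>C. ?f x) = ?f ?o + (\<Sum>x\<in>C - {?o}. ?f x)"
    by (simp add: sum.remove)
  moreover have "(\<Sum>x\<in>C - {?o}. ?f x) \<ge> 0"
  proof (rule sum_nonneg)
    fix x assume "x \<in> C - {?o}"
    then have "n div 3 + 1 \<le> num1 n x div 2 + num2 n x"
      using extremal_weight[OF assms(1) C, of x] by (simp add: weight_def)
    then show "0 \<le> ?f x"
      using T nonneg_from_entry by (auto simp: certificate_def)
  qed
  moreover have "?f ?o = hd (hd T)"
  proof -
    have "num1 n ?o = 0" "num2 n ?o = 0"
      by (auto simp: num1_def num2_def one_words zero_prod_def)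
    then show ?thesis using T
      by (auto simp: certificate_def entry_def nth_default_def hd_conv_nth)
  qed
  moreover have "(\<Sum>x\<in>C. ?f x) = 0"
    using sum_entry_eq_0[OF C'] T by (simp add: certificate_def)
  ultimately show False using T by (simp add: certificate_def)
qed

text \<open>With \<open>K = n div 3 + 1\<close>, the inequality forced by the code contradicts the
  strict one for binomial coefficients.\<close>

theorem no_extremal_large:
  assumes n: "6 \<le> n div 3 + 1 - n mod 3"
  shows "\<not> extremal_even_self_dual n C"
proof
  assume C: "extremal_even_self_dual n C"
  then have C': "L_code n C" "even_code n C" "self_dual n C"
    by (auto simp: extremal_even_self_dual_def)
  have n1: "n \<ge> 1" using n by auto
  let ?m = "n div 3" and ?\<rho> = "n mod 3"
  have \<rho>: "?\<rho> \<le> 2" "?m + 1 \<ge> 6 + ?\<rho>"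
    using n by (simp, linarith)
  have "(3 * real (?m + 1) / 2 + 3 - real ?\<rho>) * fps_nth (kern (2 - ?\<rho>) (?m + 1)) (?m + 1)
      \<ge> fps_nth (kern (5 - ?\<rho>) (?m + 2)) (?m + 2)"
    by (rule leading_kern_inequality[OF C' _ \<rho>(1) extremal_weight[OF n1 C]]) simp_all
  with kern_inequality[OF \<rho>] show False by (simp add: numeral_2_eq_2)
qed

lemma extremal_graph_codeI:
  assumes "length G = n" "n \<ge> 1" "d = 2 * (n div 3) + 2" "check_graph d G xs"
  shows "\<exists>C. extremal_even_self_dual n C"
  using assms extremal_graph_code by blast

section \<open>Certificates for the lengths 9, 12, 13, 16, 17, 20\<close>

lemma certificate_9: "certificate 9
    [[792, 664, -22, -75, 0, 0, 0, 9], [636, -68, -86], [52, -156, 0, 25], [-360, 0, 36]]"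
  by code_simp

lemma certificate_12: "certificate 12
    [[4455, 2970, 540, -162, -90, 0, 0, 0, 9], [4860, 498, -264, -105, 0, 0, 0, 5], [1202, -383,
     -186, 1, 15], [-720, -335, 0, 21], [-515]]"
  by code_simp

lemma certificate_13: "certificate 13
    [[4519515, 6498888, -1529880, 588252, -797238, 200288, 0, 90132, 14977, 0, 1392], [10770936,
     1670688, -62148, -388820, 0, 0, 0, 5952], [2052042, -484904, -451782, 0, 13353], [-832638,
     -539940], [-686135, 0, 0, 0, 0, 516832]]"
  by code_simp

lemma certificate_16: "certificate 16
    [[15020955702480, 19359995016180, 5641379687580, 356423113137, -387539919012, -154489631670, 0,
     14462748909, 0, 0, 0, 0, 7327546368], [32679865038366, 8896281158622, 562466763258,
     -607401190179, -227242196022, 0, 14309066890, 0, 1361596020], [14812210740636, 689934897888,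
     -962811991320, -338574273261, 0, 21461686300, 0, 0, 2113984], [1105711091970, -1462764526338,
     -502552101222, 0, 31624782588, 1273231480], [-2524795576688, -746771833752, 0, 33530817120, 0,
     4830083584], [-905999458140]]"
  by code_simp

lemma certificate_17: "certificate 17
    [[1373336548416, 51488002903344, 333538058154, 2037658591332, -1273611462552, 115914886536, 0,
     0, 0, 0, 0, 0, 0, 0, 0, 46143816684], [40966299636864, 18074348820920, 1398311475416,
     -762974227008, -355334752698, 0, 0, 18377834020], [19280321990892, 2739848549280,
     -1216869605102, -609341181948], [4363773007134, -1705874114736, -998648794260, 0, 27996471207],
     [-2228455800984, -1629131522984, 0, 104383273560, 4916217520, 0, 3836431974, 0, 0,
     76516727448], [-2637404907438, 0, 361380132120, 0, 1471233930, 62390036176], [0, 1246474445280,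
     0, 0, 246487534620, 181696691040]]"
  by code_simp

lemma certificate_20: "certificate 20
    [[459486929612328859270346176, 7663281832405207018521961776, 1836750947752674265072532138,
     352954219686239461231491328, -38155062351045026221217376, -38057939110521629198400766,
     -8497454118463972284667473, 0, 0, 0, 855313496817409529783919, 0, 0, 291532914648674667996027,
     0, 762203904511413354915771, 1394454345068929512425232], [8507488297712090287072875184,
     3061126275036865992155633208, 558201780818973884615702984, -38280277678792989615356402,
     -53039181238890902069394912, -12684426915126605711770027], [5049776074966250302023575840,
     888395674124265330767273376, -43382522249470691100433729, -82675335586243006276490120,
     -21628818675707785128687456, 0, 686899656744539065091155, 0, 0, 0, 1660842158102358355998],
     [1666246975693418885711992984, -37891377596654153113054716, -132522841237115552015748310,
     -35995567291246719122408418, 0, 1492526193047326877365032, 0, 0, 30639190398237567598488, 0, 0,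
     0, 20734283703429349526616], [-29272438432082932479622208, -211892400793327710221048136,
     -58615650069955109361586021, 0, 2742797439470213324300880, 208754119277022695491934, 0,
     38911987479635108737588, 0, 44030742349973445495864], [-367868607816928337256492536,
     -101400843238686608411104380, 0, 4238968713437089672483772, 0, 90944188830497787841533,
     393436091521402600309622, 0, 0, 427332508159718606772112], [-150935925612998406956304240]]"
  by code_simp

text \<open>
  Circulant graphs, except for \<open>n = 3\<close> and for \<open>n = 11\<close>, where the graph was found by a search among
  those with an automorphism of order 5 that fixes one vertex.
\<close>

lemma extremal_1: "\<exists>C. extremal_even_self_dual 1 C"
  by (rule extremal_graph_codeI[of "
    [[]]"
      1 2 "[0]"]) code_simp+

lemma extremal_2: "\<exists>C. extremal_even_self_dual 2 C"
  by (rule extremal_graph_codeI[of "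
    [[], []]"
      2 2 "[0]"]) code_simp+

lemma extremal_3: "\<exists>C. extremal_even_self_dual 3 C"
  by (rule extremal_graph_codeI[of "
    [[1], [0, 2], [1]]"
      3 4 "[0]"]) code_simp+

lemma extremal_4: "\<exists>C. extremal_even_self_dual 4 C"
  by (rule extremal_graph_codeI[of "
    [[1, 3], [0, 2], [1, 3], [0, 2]]"
      4 4 "[0, 2]"]) code_simp+

lemma extremal_5: "\<exists>C. extremal_even_self_dual 5 C"
  by (rule extremal_graph_codeI[of "
    [[1, 4], [0, 2], [1, 3], [2, 4], [0, 3]]"
      5 4 "[0, 1, 3]"]) code_simp+

lemma extremal_6: "\<exists>C. extremal_even_self_dual 6 C"
  by (rule extremal_graph_codeI[of "
    [[2, 3, 4], [3, 4, 5], [0, 4, 5], [0, 1, 5], [0, 1, 2], [1, 2, 3]]"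
      6 6 "[0, 2]"]) code_simp+

lemma extremal_7: "\<exists>C. extremal_even_self_dual 7 C"
  by (rule extremal_graph_codeI[of "
    [[1, 6], [0, 2], [1, 3], [2, 4], [3, 5], [4, 6], [0, 5]]"
      7 6 "[0]"]) code_simp+

lemma extremal_8: "\<exists>C. extremal_even_self_dual 8 C"
  by (rule extremal_graph_codeI[of "
    [[1, 7], [0, 2], [1, 3], [2, 4], [3, 5], [4, 6], [5, 7], [0, 6]]"
      8 6 "[0]"]) code_simp+

lemma extremal_10: "\<exists>C. extremal_even_self_dual 10 C"
  by (rule extremal_graph_codeI[of "
    [[1, 5, 9], [0, 2, 6], [1, 3, 7], [2, 4, 8], [3, 5, 9], [0, 4, 6], [1, 5, 7], [2, 6, 8], [3, 7,
     9], [0, 4, 8]]"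
      10 8 "[0]"]) code_simp+

lemma extremal_11: "\<exists>C. extremal_even_self_dual 11 C"
  by (rule extremal_graph_codeI[of "
    [[2, 3, 5, 6, 7, 10], [3, 4, 6, 7, 8, 10], [0, 4, 7, 8, 9, 10], [0, 1, 5, 8, 9, 10], [1, 2, 5,
     6, 9, 10], [0, 3, 4, 7, 8], [0, 1, 4, 8, 9], [0, 1, 2, 5, 9], [1, 2, 3, 5, 6], [2, 3, 4, 6, 7],
     [0, 1, 2, 3, 4]]"
      11 8 "[0, 1, 2, 7]"]) code_simp+

theorem theorem4p14:
  shows "(\<forall>n\<in>{1, 2, 3, 4, 5, 6, 7, 8, 10, 11::nat}. \<exists>C. extremal_even_self_dual n C) \<and>
         (\<forall>n::nat. n \<ge> 1 \<and> n \<notin> {1, 2, 3, 4, 5, 6, 7, 8, 10, 11, 14} \<longrightarrow>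
            \<not> (\<exists>C. extremal_even_self_dual n C))"
proof (intro conjI allI impI notI ballI)
  fix n :: nat
  assume "n \<in> {1, 2, 3, 4, 5, 6, 7, 8, 10, 11}"
  then show "\<exists>C. extremal_even_self_dual n C"
    using extremal_1 extremal_2 extremal_3 extremal_4 extremal_5 extremal_6 extremal_7 extremal_8
      extremal_10 extremal_11 by auto
next
  fix n :: nat
  assume n: "n \<ge> 1 \<and> n \<notin> {1, 2, 3, 4, 5, 6, 7, 8, 10, 11, 14}"
  assume "\<exists>C. extremal_even_self_dual n C"
  then obtain C where C: "extremal_even_self_dual n C" by blast
  \<comment> \<open>From 21 on, \<open>n div 3 \<ge> 7\<close> and \<open>n mod 3 \<le> 2\<close>.
    Below, the candidates left are these six and 15, 18, 19, which satisfy the inequality.\<close>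
  have "n \<in> {9, 12, 13, 16, 17, 20} \<or> 6 \<le> n div 3 + 1 - n mod 3"
  proof (cases "n \<le> 20")
    case True
    then have "n \<in> set [0..<21]" by simp
    then show ?thesis using n by (simp add: upt_conv_Cons) auto
  next
    case False
    then have "7 \<le> n div 3" by simp
    moreover have "n mod 3 < 3" by simp
    ultimately have "6 \<le> n div 3 + 1 - n mod 3" by linarith
    then show ?thesis ..
  qed
  then show False
  proof
    assume "n \<in> {9, 12, 13, 16, 17, 20}"
    then show False
      using C certificate_excludes[OF _ certificate_9] certificate_excludes[OF _ certificate_12]
        certificate_excludes[OF _ certificate_13] certificate_excludes[OF _ certificate_16]
        certificate_excludes[OF _ certificate_17] certificate_excludes[OF _ certificate_20]
      by auto
  next
    assume "6 \<le> n div 3 + 1 - n mod 3"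
    then show False using no_extremal_large C by blast
  qed
qed

end
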